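(* Let $(\mathcal{U},\|\cdot\|_{\mathcal{U}})$ be a Banach ideal of $N$-linear mappings with $N\ge2$ and let $Y\neq\{0\}$ be any Banach space. Then the Lindenstrauss-Bollobás property ($LBp$) fails for $\mathcal{U}(\ell_1\times\cdots\times\ell_1;Y)$ ($N$ factors $\ell_1$).
   Context: Notation: $\mathbb{K}$ is the scalar field ($\mathbb{R}$ or $\mathbb{C}$), $X'$ the topological dual of $X$, $S_X$ the unit sphere. For $\mathbf{X}=X_1\times\cdots\times X_N$, $\mathcal{L}(^N\mathbf{X};Y)$ is the space of continuous $N$-linear mappings $\mathbf{X}\to Y$ with the supremum norm $\|\cdot\|$; $\mathbf{X}''=X_1''\times\cdots\times X_N''$; $S_{\mathbf{X}}=S_{X_1}\times\cdots\times S_{X_N}$, with distances measured in the norm $\|\mathbf{x}\|=\max_j\|x_j\|$. Ideal of $N$-linear mappings: a normed ideal of $N$-linear mappings is a pair $(\mathcal{U},\|\cdot\|_{\mathcal{U}})$ such that for every $N$-tuple of Banach spaces $\mathbf{X}$: (i) for every Banach space $Y$, $\mathcal{U}(\mathbf{X};Y)=\mathcal{U}\cap\mathcal{L}(^N\mathbf{X};Y)$ is a linear subspace of $\mathcal{L}(^N\mathbf{X};Y)$ and $\|\cdot\|_{\mathcal{U}}$ is a norm on it; (ii) for all Banach spaces $Z_1,\dots,Z_N,Y,W$, bounded linear operators $T_i:Z_i\to X_i$, $S:Y\to W$ and $\Phi\in\mathcal{U}(\mathbf{X};Y)$, the mapping $S\circ\Phi\circ(T_1,\dots,T_N)$ belongs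 to $\mathcal{U}(Z_1\times\cdots\times Z_N;W)$ with $\|S\circ\Phi\circ(T_1,\dots,T_N)\|_{\mathcal{U}}\le\|S\|\|\Phi\|_{\mathcal{U}}\|T_1\|\cdots\|T_N\|$; (iii) $(z_1,\dots,z_N)\mapsto z_1\cdots z_N$ belongs to $\mathcal{U}(\mathbb{K}^N;\mathbb{K})$ and has $\mathcal{U}$-norm one. It is a Banach ideal if every $(\mathcal{U}(\mathbf{X};Y),\|\cdot\|_{\mathcal{U}})$ is complete. Arens extension: for $\Psi\in\mathcal{L}(^N\mathbf{X};Y)$, $\overline{\Psi}:X_1''\times\cdots\times X_N''\to Y''$ is $\overline{\Psi}(x_1'',\dots,x_N'')=w^*\text{-}\lim_{\alpha_1}\cdots\lim_{\alpha_N}\Psi(x_{1,\alpha_1},\dots,x_{N,\alpha_N})$, where $(x_{j,\alpha_j})_{\alpha_j}\subset X_j$ is a bounded net $w^*$-convergent to $x_j''$. $LBp$: $\mathcal{U}(\mathbf{X};Y)$ has the Lindenstrauss-Bollobás property if for each $\varepsilon>0$ there exist $\beta(\varepsilon)>0$ and $\eta(\varepsilon)>0$, with $\lim_{\varepsilon\to0^+}\beta(\varepsilon)=0$, such that whenever $\Phi\in\mathcal{U}(\mathbf{X};Y)$, $\|\Phi\|=1$, and $\tilde{\mathbf{x}}\in S_{\mathbf{X}}$ satisfy $\|\Phi(\tilde{\mathbf{x}})\|>1-\eta(\varepsilon)$, there exist $\Psi\in\mathcal{U}(\mathbf{X};Y)$ with $\|\Psi\|=1$ and $\mathbf{a}''\in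 S_{\mathbf{X}''}$ such that $\|\overline{\Psi}(\mathbf{a}'')\|=1$, $\|\mathbf{a}''-\tilde{\mathbf{x}}\|<\beta(\varepsilon)$ and $\|\Psi-\Phi\|_{\mathcal{U}}<\varepsilon$. *)

theory Defs
  imports "HOL-Analysis.Analysis" "HOL-Algebra.Module"
begin

section \<open>Normed and Banach spaces\<close>

text \<open>
  The scalar field is a type of class \<open>{real_normed_field, banach}\<close>; by the Gelfand-Mazur theorem
  such a field is the real or the complex field, and both are instances.  Normed spaces are modules
  on an explicit carrier, so that one can quantify over all Banach spaces.  The ring multiplication
  and unit that the record inherits are used only for the scalar field itself.
\<close>

record ('k, 'a) nspace = "('k, 'a) module" +
  nrm :: "'a \<Rightarrow> real"

definition scalars :: "('k::{real_normed_field,banach}, 'k) nspace" where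
  "scalars = \<lparr>carrier = UNIV, monoid.mult = (*), one = 1, ring.zero = 0, add = (+),
              smult = (*), nrm = norm\<rparr>"

definition normed_space :: "('k::{real_normed_field,banach}, 'a) nspace \<Rightarrow> bool" where
  "normed_space X \<longleftrightarrow>
     Module.module scalars X \<and>
     (\<forall>x\<in>carrier X. 0 \<le> nrm X x \<and> (nrm X x = 0 \<longleftrightarrow> x = \<zero>\<^bsub>X\<^esub>)) \<and>
     (\<forall>c. \<forall>x\<in>carrier X. nrm X (c \<odot>\<^bsub>X\<^esub> x) = norm c * nrm X x) \<and>
     (\<forall>x\<in>carrier X. \<forall>y\<in>carrier X. nrm X (x \<oplus>\<^bsub>X\<^esub> y) \<le> nrm X x + nrm X y)"

text \<open>The cut-off outside the carrier is needed because \<^locale>\<open>Metric_space\<close> demands a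
  nonnegative symmetric distance on the whole type.\<close>

definition ndist :: "('k, 'a) nspace \<Rightarrow> 'a \<Rightarrow> 'a \<Rightarrow> real" where
  "ndist X x y = (if x \<in> carrier X \<and> y \<in> carrier X then nrm X (x \<ominus>\<^bsub>X\<^esub> y) else 0)"

definition norm_topology :: "('k, 'a) nspace \<Rightarrow> 'a topology" where
  "norm_topology X = Metric_space.mtopology (carrier X) (ndist X)"

definition banach_space :: "('k::{real_normed_field,banach}, 'a) nspace \<Rightarrow> bool" where
  "banach_space X \<longleftrightarrow> normed_space X \<and> Metric_space.mcomplete (carrier X) (ndist X)"

definition unit_sphere :: "('k, 'a) nspace \<Rightarrow> 'a set" where
  "unit_sphere X = {x \<in> carrier X. nrm X x = 1}"


section \<open>Operators, duals and multilinear mappings\<close>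

text \<open>Mappings are extensional (equal to \<^const>\<open>undefined\<close> outside their domain), so that
  equality of mappings is equality on the domain.\<close>

definition op_space ::
  "('k, 'a) nspace \<Rightarrow> ('k, 'b) nspace \<Rightarrow> ('k, 'a \<Rightarrow> 'b) nspace" where
  "op_space X Y =
     \<lparr>carrier = {T \<in> carrier X \<rightarrow>\<^sub>E carrier Y.
        (\<forall>x\<in>carrier X. \<forall>y\<in>carrier X. T (x \<oplus>\<^bsub>X\<^esub> y) = T x \<oplus>\<^bsub>Y\<^esub> T y) \<and>
        (\<forall>c. \<forall>x\<in>carrier X. T (c \<odot>\<^bsub>X\<^esub> x) = c \<odot>\<^bsub>Y\<^esub> T x) \<and>
        continuous_map (norm_topology X) (norm_topology Y) T},
      monoid.mult = undefined, one = undefined,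
      ring.zero = (\<lambda>x\<in>carrier X. \<zero>\<^bsub>Y\<^esub>),
      add = (\<lambda>S T. \<lambda>x\<in>carrier X. S x \<oplus>\<^bsub>Y\<^esub> T x),
      smult = (\<lambda>c T. \<lambda>x\<in>carrier X. c \<odot>\<^bsub>Y\<^esub> T x),
      nrm = (\<lambda>T. Sup {nrm Y (T x) | x. x \<in> carrier X \<and> nrm X x \<le> 1})\<rparr>"

definition dual :: "('k::{real_normed_field,banach}, 'a) nspace \<Rightarrow> ('k, 'a \<Rightarrow> 'k) nspace" where
  "dual X = op_space X scalars"

abbreviation bidual ::
  "('k::{real_normed_field,banach}, 'a) nspace \<Rightarrow> ('k, ('a \<Rightarrow> 'k) \<Rightarrow> 'k) nspace" where
  "bidual X \<equiv> dual (dual X)"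

definition canon :: "('k::{real_normed_field,banach}, 'a) nspace \<Rightarrow> 'a \<Rightarrow> ('a \<Rightarrow> 'k) \<Rightarrow> 'k" where
  "canon X x = (\<lambda>f\<in>carrier (dual X). f x)"

abbreviation tuples :: "nat \<Rightarrow> (nat \<Rightarrow> ('k, 'a) nspace) \<Rightarrow> (nat \<Rightarrow> 'a) set" where
  "tuples N X \<equiv> (\<Pi>\<^sub>E j\<in>{..<N}. carrier (X j))"

definition multilin_space ::
  "nat \<Rightarrow> (nat \<Rightarrow> ('k, 'a) nspace) \<Rightarrow> ('k, 'b) nspace \<Rightarrow> ('k, (nat \<Rightarrow> 'a) \<Rightarrow> 'b) nspace" where
  "multilin_space N X Y =
     \<lparr>carrier = {\<Phi> \<in> tuples N X \<rightarrow>\<^sub>E carrier Y.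
        (\<forall>j<N. \<forall>x\<in>tuples N X. \<forall>s\<in>carrier (X j). \<forall>t\<in>carrier (X j).
           \<Phi> (x(j := s \<oplus>\<^bsub>X j\<^esub> t)) = \<Phi> (x(j := s)) \<oplus>\<^bsub>Y\<^esub> \<Phi> (x(j := t))) \<and>
        (\<forall>j<N. \<forall>x\<in>tuples N X. \<forall>c. \<forall>s\<in>carrier (X j).
           \<Phi> (x(j := c \<odot>\<^bsub>X j\<^esub> s)) = c \<odot>\<^bsub>Y\<^esub> \<Phi> (x(j := s))) \<and>
        continuous_map (product_topology (\<lambda>j. norm_topology (X j)) {..<N}) (norm_topology Y) \<Phi>},
      monoid.mult = undefined, one = undefined,
      ring.zero = (\<lambda>x\<in>tuples N X. \<zero>\<^bsub>Y\<^esub>),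
      add = (\<lambda>\<Phi> \<Psi>. \<lambda>x\<in>tuples N X. \<Phi> x \<oplus>\<^bsub>Y\<^esub> \<Psi> x),
      smult = (\<lambda>c \<Phi>. \<lambda>x\<in>tuples N X. c \<odot>\<^bsub>Y\<^esub> \<Phi> x),
      nrm = (\<lambda>\<Phi>. Sup {nrm Y (\<Phi> x) | x. x \<in> tuples N X \<and> (\<forall>j<N. nrm (X j) (x j) \<le> 1)})\<rparr>"


section \<open>The Arens extension\<close>

text \<open>
  Nets are represented by filters.  \<open>wstar_tendsto X h z F\<close>: the \<open>X''\<close>-valued net \<open>h\<close>, indexed
  along \<open>F\<close>, converges to \<open>z\<close> in the weak-star topology.
\<close>

definition wstar_tendsto ::
  "('k::{real_normed_field,banach}, 'a) nspace \<Rightarrow> ('i \<Rightarrow> ('a \<Rightarrow> 'k) \<Rightarrow> 'k) \<Rightarrow>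
   (('a \<Rightarrow> 'k) \<Rightarrow> 'k) \<Rightarrow> 'i filter \<Rightarrow> bool" where
  "wstar_tendsto X h z F \<longleftrightarrow> (\<forall>f\<in>carrier (dual X). ((\<lambda>t. h t f) \<longlongrightarrow> z f) F)"

text \<open>A bounded net in \<open>X\<close> that is weak-star convergent to \<open>z \<in> X''\<close>.\<close>

definition bounded_wstar_net ::
  "('k::{real_normed_field,banach}, 'a) nspace \<Rightarrow> (('a \<Rightarrow> 'k) \<Rightarrow> 'k) \<Rightarrow> 'a filter \<Rightarrow> bool" where
  "bounded_wstar_net X z F \<longleftrightarrow>
     F \<noteq> bot \<and> (\<exists>C. eventually (\<lambda>t. t \<in> carrier X \<and> nrm X t \<le> C) F) \<and> wstar_tendsto X (canon X) z F"

text \<open>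
  \<open>iterated_wlim N X Y F \<Psi> k x z\<close>: with the coordinates \<open>x 0, \<dots>, x (k-1)\<close> held fixed, the
  iterated weak-star limit in the space \<open>Y''\<close> of \<open>\<Psi>\<close> along \<open>F k\<close> (outermost), \<dots>, \<open>F (N-1)\<close> (innermost)
  exists and equals \<open>z\<close>.
\<close>

inductive iterated_wlim ::
  "nat \<Rightarrow> (nat \<Rightarrow> ('k::{real_normed_field,banach}, 'a) nspace) \<Rightarrow> ('k, 'b) nspace \<Rightarrow>
   (nat \<Rightarrow> 'a filter) \<Rightarrow> ((nat \<Rightarrow> 'a) \<Rightarrow> 'b) \<Rightarrow>
   nat \<Rightarrow> (nat \<Rightarrow> 'a) \<Rightarrow> (('b \<Rightarrow> 'k) \<Rightarrow> 'k) \<Rightarrow> bool"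
  for N X Y F \<Psi> where
  base: "iterated_wlim N X Y F \<Psi> N x (canon Y (\<Psi> x))"
| step: "\<lbrakk>k < N;
         \<forall>t\<in>carrier (X k). h t \<in> carrier (bidual Y) \<and> iterated_wlim N X Y F \<Psi> (Suc k) (x(k := t)) (h t);
         z \<in> carrier (bidual Y); wstar_tendsto Y h z (F k)\<rbrakk>
        \<Longrightarrow> iterated_wlim N X Y F \<Psi> k x z"

text \<open>
  \<open>\<Psi>''\<close> is the Arens extension of \<open>\<Psi>\<close>.  By Goldstine's theorem bounded nets as required exist for
  every \<open>a\<close>, and the iterated limit along them does not depend on their choice; hence exactly one
  function on \<open>X\<^sub>1'' \<times> \<dots> \<times> X\<^sub>N''\<close> has this property.
\<close>

definition arens_extension ::
  "nat \<Rightarrow> (nat \<Rightarrow> ('k::{real_normed_field,banach}, 'a) nspace) \<Rightarrow> ('k, 'b) nspace \<Rightarrow>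
   ((nat \<Rightarrow> 'a) \<Rightarrow> 'b) \<Rightarrow> ((nat \<Rightarrow> ('a \<Rightarrow> 'k) \<Rightarrow> 'k) \<Rightarrow> ('b \<Rightarrow> 'k) \<Rightarrow> 'k) \<Rightarrow> bool" where
  "arens_extension N X Y \<Psi> \<Psi>'' \<longleftrightarrow>
     (\<forall>a \<in> tuples N (\<lambda>j. bidual (X j)).
        \<exists>F. (\<forall>j<N. bounded_wstar_net (X j) (a j) (F j)) \<and>
            iterated_wlim N X Y F \<Psi> 0 (\<lambda>_. undefined) (\<Psi>'' a))"


section \<open>The universe of Banach spaces\<close>

text \<open>
  Elements of Banach spaces are taken from one type, which contains copies of the scalar field and
  of the scalar sequences (so that it accommodates \<open>K\<close> and \<open>l\<^sub>1\<close>) and an arbitrary type \<open>'v\<close>.  As \<open>'v\<close>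
  is arbitrary, every set of Banach spaces is represented, up to renaming of elements, by spaces
  with carriers in this type for suitable \<open>'v\<close>.
\<close>

datatype ('k, 'v) point = Scalar (the_scalar: 'k) | Seq (the_seq: "nat \<Rightarrow> 'k") | Other 'v

type_synonym ('k, 'v) uspace = "('k, ('k, 'v) point) nspace"

text \<open>The copy of \<open>X\<close> under the renaming \<open>f\<close> with inverse \<open>g\<close>.\<close>

definition copy_space ::
  "('a \<Rightarrow> 'b) \<Rightarrow> ('b \<Rightarrow> 'a) \<Rightarrow> ('k, 'a) nspace \<Rightarrow> ('k, 'b) nspace" where
  "copy_space f g X =
     \<lparr>carrier = f ` carrier X,
      monoid.mult = undefined, one = undefined,
      ring.zero = f \<zero>\<^bsub>X\<^esub>,
      add = (\<lambda>x y. f (g x \<oplus>\<^bsub>X\<^esub> g y)),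
      smult = (\<lambda>c x. f (c \<odot>\<^bsub>X\<^esub> g x)),
      nrm = (\<lambda>x. nrm X (g x))\<rparr>"

definition l1_seqs :: "('k::{real_normed_field,banach}, nat \<Rightarrow> 'k) nspace" where
  "l1_seqs =
     \<lparr>carrier = {x. summable (\<lambda>n. norm (x n))},
      monoid.mult = undefined, one = undefined,
      ring.zero = (\<lambda>n. 0),
      add = (\<lambda>x y n. x n + y n),
      smult = (\<lambda>c x n. c * x n),
      nrm = (\<lambda>x. \<Sum>n. norm (x n))\<rparr>"

definition scalar_space :: "('k::{real_normed_field,banach}, 'v) uspace" where
  "scalar_space = copy_space Scalar the_scalar scalars"

definition ell1 :: "('k::{real_normed_field,banach}, 'v) uspace" where
  "ell1 = copy_space Seq the_seq l1_seqs"


section \<open>Ideals of multilinear mappings\<close>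

text \<open>An ideal is given by its components \<open>U X Y\<close> and the norms \<open>nU X Y\<close> on them, where
  \<open>X 0, \<dots>, X (N-1)\<close> are the domain spaces.\<close>

type_synonym ('k, 'v) mclass =
  "(nat \<Rightarrow> ('k, 'v) uspace) \<Rightarrow> ('k, 'v) uspace \<Rightarrow> ((nat \<Rightarrow> ('k, 'v) point) \<Rightarrow> ('k, 'v) point) set"

type_synonym ('k, 'v) mnorm =
  "(nat \<Rightarrow> ('k, 'v) uspace) \<Rightarrow> ('k, 'v) uspace \<Rightarrow> ((nat \<Rightarrow> ('k, 'v) point) \<Rightarrow> ('k, 'v) point) \<Rightarrow> real"

definition ideal_space ::
  "nat \<Rightarrow> ('k, 'v) mclass \<Rightarrow> ('k, 'v) mnorm \<Rightarrow> (nat \<Rightarrow> ('k, 'v) uspace) \<Rightarrow> ('k, 'v) uspace \<Rightarrow>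
   ('k, (nat \<Rightarrow> ('k, 'v) point) \<Rightarrow> ('k, 'v) point) nspace" where
  "ideal_space N U nU X Y = (multilin_space N X Y) \<lparr>carrier := U X Y, nrm := nU X Y\<rparr>"

definition normed_ideal ::
  "nat \<Rightarrow> ('k::{real_normed_field,banach}, 'v) mclass \<Rightarrow> ('k, 'v) mnorm \<Rightarrow> bool" where
  "normed_ideal N U nU \<longleftrightarrow>
     (\<forall>X Y. (\<forall>j<N. banach_space (X j)) \<and> banach_space Y \<longrightarrow>
        submodule (U X Y) scalars (multilin_space N X Y) \<and>
        normed_space (ideal_space N U nU X Y)) \<and>
     (\<forall>X Z Y W T S \<Phi>.
        (\<forall>j<N. banach_space (X j) \<and> banach_space (Z j)) \<and> banach_space Y \<and> banach_space W \<and>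
        (\<forall>j<N. T j \<in> carrier (op_space (Z j) (X j))) \<and> S \<in> carrier (op_space Y W) \<and> \<Phi> \<in> U X Y \<longrightarrow>
        (let \<Theta> = (\<lambda>z\<in>tuples N Z. S (\<Phi> (\<lambda>j\<in>{..<N}. T j (z j))))
         in \<Theta> \<in> U Z W \<and>
            nU Z W \<Theta> \<le> nrm (op_space Y W) S * nU X Y \<Phi> * (\<Prod>j<N. nrm (op_space (Z j) (X j)) (T j)))) \<and>
     (let \<pi> = (\<lambda>z\<in>tuples N (\<lambda>_. scalar_space). Scalar (\<Prod>j<N. the_scalar (z j)))
      in \<pi> \<in> U (\<lambda>_. scalar_space) scalar_space \<and> nU (\<lambda>_. scalar_space) scalar_space \<pi> = 1)"

definition banach_ideal ::
  "nat \<Rightarrow> ('k::{real_normed_field,banach}, 'v) mclass \<Rightarrow> ('k, 'v) mnorm \<Rightarrow> bool" where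
  "banach_ideal N U nU \<longleftrightarrow>
     normed_ideal N U nU \<and>
     (\<forall>X Y. (\<forall>j<N. banach_space (X j)) \<and> banach_space Y \<longrightarrow> banach_space (ideal_space N U nU X Y))"


section \<open>The Lindenstrauss-Bollobas property\<close>

definition LBp ::
  "nat \<Rightarrow> ('k::{real_normed_field,banach}, 'v) mclass \<Rightarrow> ('k, 'v) mnorm \<Rightarrow>
   (nat \<Rightarrow> ('k, 'v) uspace) \<Rightarrow> ('k, 'v) uspace \<Rightarrow> bool" where
  "LBp N U nU X Y \<longleftrightarrow>
     (\<exists>\<beta> \<eta> :: real \<Rightarrow> real.
        (\<forall>\<epsilon>>0. \<beta> \<epsilon> > 0 \<and> \<eta> \<epsilon> > 0) \<and> (\<beta> \<longlongrightarrow> 0) (at_right 0) \<and>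
        (\<forall>\<epsilon>>0. \<forall>\<Phi>\<in>U X Y. \<forall>x \<in> (\<Pi>\<^sub>E j\<in>{..<N}. unit_sphere (X j)).
           nrm (multilin_space N X Y) \<Phi> = 1 \<and> nrm Y (\<Phi> x) > 1 - \<eta> \<epsilon> \<longrightarrow>
           (\<exists>\<Psi>\<in>U X Y. \<exists>\<Psi>''. \<exists>a \<in> (\<Pi>\<^sub>E j\<in>{..<N}. unit_sphere (bidual (X j))).
              nrm (multilin_space N X Y) \<Psi> = 1 \<and>
              arens_extension N X Y \<Psi> \<Psi>'' \<and> nrm (bidual Y) (\<Psi>'' a) = 1 \<and>
              Max ((\<lambda>j. nrm (bidual (X j)) (a j \<ominus>\<^bsub>bidual (X j)\<^esub> canon (X j) (x j))) ` {..<N}) < \<beta> \<epsilon> \<and>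
              nrm (ideal_space N U nU X Y) (\<Psi> \<ominus>\<^bsub>ideal_space N U nU X Y\<^esub> \<Phi>) < \<epsilon>)))"

end

theory Submission
  imports Defs
begin

text \<open>
  The counterexample is the multilinear version of the bilinear form of Choi and Song: with
  \<open>z\<^sub>k(i)\<close> the \<open>i\<close>-th entry of \<open>z\<^sub>k \<in> l\<^sub>1\<close> and \<open>y\<close> a unit vector of \<open>Y\<close>, let \<open>\<Phi>(z)\<close> be
  \<open>y\<close> times the sum of \<open>z\<^sub>0(i) z\<^sub>1(j) z\<^sub>2(0) z\<^sub>3(0) \<dots>\<close> over all \<open>i \<noteq> j\<close> below \<open>m\<close>.  It has norm one
  and takes a value of norm \<open>1 - 1/m\<close> when \<open>z\<^sub>0\<close> and \<open>z\<^sub>1\<close> are the uniform distribution on the first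
  \<open>m\<close> coordinates.  If \<open>\<Psi>\<close> is close to \<open>\<Phi>\<close> in the ideal norm, its values at the diagonal basis tuples
  have norm at most \<open>\<epsilon> < 1\<close>.  Hence, if \<open>a\<^sub>0\<close> and \<open>a\<^sub>1\<close> both charge some coordinate \<open>i < m\<close>, as they do when
  they are within \<open>1/2\<close> of the uniform distribution, then \<open>\<Psi>\<close> can be enlarged at that diagonal entry
  without leaving the unit ball, and the extension of \<open>\<Psi>\<close> has norm less than one at \<open>a\<close>.

  The Hahn-Banach theorem is not needed: the values of the Arens extension lie in \<open>Y''\<close>, so their
  norms are by definition computed with functionals on \<open>Y\<close>, and one can argue with \<open>f \<circ> \<Psi>\<close>
  for \<open>f\<close> in the unit ball of \<open>Y'\<close>.
\<close>

section \<open>Normed spaces\<close>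

lemma scalars_simps [simp]:
  "carrier scalars = UNIV" "monoid.mult scalars = (*)" "one scalars = 1" "ring.zero scalars = 0"
  "add scalars = (+)" "smult scalars = (*)" "nrm scalars = norm"
  by (simp_all add: scalars_def)

lemma cring_scalars: "cring (scalars :: ('k::{real_normed_field,banach}, 'k) nspace)"
proof (rule cringI)
  show "abelian_group (scalars :: ('k, 'k) nspace)"
  proof (rule abelian_groupI)
    fix x :: 'k
    show "\<exists>y\<in>carrier scalars. y \<oplus>\<^bsub>scalars\<^esub> x = \<zero>\<^bsub>scalars\<^esub>"
      by (rule bexI[of _ "-x"]) auto
  qed auto
  show "Group.comm_monoid (scalars :: ('k, 'k) nspace)"
    by (rule comm_monoidI) auto
qed (auto simp: algebra_simps)

lemma normed_space_scalars: "normed_space (scalars :: ('k::{real_normed_field,banach}, 'k) nspace)"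
proof -
  have "Module.module scalars (scalars :: ('k, 'k) nspace)"
    by (rule moduleI) (auto simp: cring_scalars cring.axioms ring_def algebra_simps
        intro: cring.axioms(1) ring.axioms(1) cring_scalars)
  then show ?thesis
    by (auto simp: normed_space_def norm_mult norm_triangle_ineq)
qed

locale nvs =
  fixes X :: "('k::{real_normed_field,banach}, 'a) nspace" (structure)
  assumes normed_space: "normed_space X"

sublocale nvs \<subseteq> Module.module scalars X
  using normed_space by (simp add: normed_space_def)

context nvs
begin

lemma nrm_nonneg [simp]: "x \<in> carrier X \<Longrightarrow> 0 \<le> nrm X x"
  and nrm_eq_0 [simp]: "x \<in> carrier X \<Longrightarrow> nrm X x = 0 \<longleftrightarrow> x = \<zero>"
  and nrm_smult [simp]: "x \<in> carrier X \<Longrightarrow> nrm X (c \<odot> x) = norm c * nrm X x"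
  and nrm_add: "x \<in> carrier X \<Longrightarrow> y \<in> carrier X \<Longrightarrow> nrm X (x \<oplus> y) \<le> nrm X x + nrm X y"
  using normed_space by (simp_all add: normed_space_def)

lemma nrm_zero [simp]: "nrm X \<zero> = 0"
  by simp

lemma zero_in: "\<zero> \<in> carrier X" and add_in: "x \<in> carrier X \<Longrightarrow> y \<in> carrier X \<Longrightarrow> x \<oplus> y \<in> carrier X"
  by simp_all

lemma smult_in [simp, intro]: "x \<in> carrier X \<Longrightarrow> c \<odot> x \<in> carrier X"
  by simp

lemma smult_smult: "x \<in> carrier X \<Longrightarrow> a \<odot> (b \<odot> x) = (a * b) \<odot> x"
  using smult_assoc1[of a b x] by simp

lemma smult_0 [simp]: "x \<in> carrier X \<Longrightarrow> 0 \<odot> x = \<zero>"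
  using smult_l_null[of x] by simp

lemma smult_1 [simp]: "x \<in> carrier X \<Longrightarrow> 1 \<odot> x = x"
  using smult_one[of x] by simp

lemma smult_add_left: "x \<in> carrier X \<Longrightarrow> (a + b) \<odot> x = a \<odot> x \<oplus> b \<odot> x"
  using smult_l_distr[of a b x] by simp

lemma smult_add_right: "x \<in> carrier X \<Longrightarrow> y \<in> carrier X \<Longrightarrow> a \<odot> (x \<oplus> y) = a \<odot> x \<oplus> a \<odot> y"
  using smult_r_distr[of a x y] by simp

lemma smult_zero [simp]: "c \<odot> \<zero> = \<zero>"
  using smult_smult[of \<zero> c 0] by simp

text \<open>The additive inverse is defined by description in the additive group. As multiplication
  by \<open>-1\<close> it can be computed in every concrete space and its norm is known.\<close>

lemma minus_eq_smult: "x \<in> carrier X \<Longrightarrow> \<ominus> x = (-1) \<odot> x"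
proof -
  assume x: "x \<in> carrier X"
  have "(-1) \<odot> x \<oplus> x = (-1 + 1) \<odot> x"
    using smult_add_left[OF x, of "-1" 1] x by simp
  then show ?thesis
    using x by (metis M.minus_equality add.left_inverse smult_0 smult_in)
qed

lemma nrm_minus [simp]: "x \<in> carrier X \<Longrightarrow> nrm X (\<ominus> x) = nrm X x"
  by (simp add: minus_eq_smult del: M.a_inv_closed)

lemma nrm_minus_commute: "x \<in> carrier X \<Longrightarrow> y \<in> carrier X \<Longrightarrow> nrm X (x \<ominus> y) = nrm X (y \<ominus> x)"
  by (metis M.minus_add M.minus_closed M.minus_minus M.a_comm M.a_inv_closed a_minus_def nrm_minus)

lemma minus_triangle: "x \<in> carrier X \<Longrightarrow> y \<in> carrier X \<Longrightarrow> z \<in> carrier X \<Longrightarrow>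
   x \<ominus> z = (x \<ominus> y) \<oplus> (y \<ominus> z)"
  by (simp add: a_minus_def M.a_assoc M.r_neg1 M.r_neg2)

lemma minus_add_cancel: "x \<in> carrier X \<Longrightarrow> y \<in> carrier X \<Longrightarrow> (x \<ominus> y) \<oplus> y = x"
  by (simp add: a_minus_def M.a_assoc M.l_neg)

lemma minus_eq_0_iff: "x \<in> carrier X \<Longrightarrow> y \<in> carrier X \<Longrightarrow> x \<ominus> y = \<zero> \<longleftrightarrow> x = y"
  by (metis minus_add_cancel M.l_zero M.r_neg a_minus_def)

section \<open>The norm metric, neighbourhoods of zero and completeness\<close>

lemma Metric_space: "Metric_space (carrier X) (ndist X)"
proof
  fix x y z
  show "0 \<le> ndist X x y" by (simp add: ndist_def)
  show "ndist X x y = ndist X y x" by (simp add: ndist_def nrm_minus_commute)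
  assume x: "x \<in> carrier X" and y: "y \<in> carrier X"
  show "ndist X x y = 0 \<longleftrightarrow> x = y"
    using x y minus_eq_0_iff[OF x y] by (simp add: ndist_def)
  assume z: "z \<in> carrier X"
  show "ndist X x z \<le> ndist X x y + ndist X y z"
    using x y z by (simp add: ndist_def minus_triangle[of x y z] nrm_add)
qed

lemma topspace_norm_topology [simp]: "topspace (norm_topology X) = carrier X"
  by (simp add: norm_topology_def Metric_space.topspace_mtopology Metric_space)

lemma ndist_zero: "x \<in> carrier X \<Longrightarrow> ndist X \<zero> x = nrm X x"
  by (simp add: ndist_def a_minus_def)

text \<open>Boundedness of linear and multilinear mappings follows from continuity at zero, and this
  is the form in which that continuity is used.\<close>

lemma zero_neighbourhood:
  assumes "openin (norm_topology X) V" "\<zero> \<in> V"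
  obtains r where "r > 0" "\<And>x. x \<in> carrier X \<Longrightarrow> nrm X x < r \<Longrightarrow> x \<in> V"
proof -
  interpret M: Metric_space "carrier X" "ndist X" by (rule Metric_space)
  obtain r where "r > 0" "M.mball \<zero> r \<subseteq> V"
    using assms unfolding norm_topology_def M.openin_mtopology by blast
  then show ?thesis
    by (intro that[of r]) (auto simp: ndist_zero subset_iff)
qed

lemma openin_unit_ball: "openin (norm_topology X) {x \<in> carrier X. nrm X x < 1}"
proof -
  interpret M: Metric_space "carrier X" "ndist X" by (rule Metric_space)
  have "{x \<in> carrier X. nrm X x < 1} = M.mball \<zero> 1"
    by (auto simp: ndist_zero)
  then show ?thesis
    by (simp add: norm_topology_def)
qed

text \<open>Replaces the cut-off distance by plain norms of differences, so that completeness can be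
  verified in concrete spaces and carried over to copies.\<close>

lemma mcomplete_iff:
  "Metric_space.mcomplete (carrier X) (ndist X) \<longleftrightarrow>
   (\<forall>\<sigma>::nat \<Rightarrow> 'a. (\<forall>n. \<sigma> n \<in> carrier X) \<and> (\<forall>e>0. \<exists>M. \<forall>m\<ge>M. \<forall>n\<ge>M. nrm X (\<sigma> m \<ominus> \<sigma> n) < e) \<longrightarrow>
      (\<exists>x\<in>carrier X. \<forall>e>0. \<exists>M. \<forall>n\<ge>M. nrm X (\<sigma> n \<ominus> x) < e))"
proof -
  interpret M: Metric_space "carrier X" "ndist X" by (rule Metric_space)
  have 1: "M.MCauchy \<sigma> \<longleftrightarrow> (\<forall>n. \<sigma> n \<in> carrier X) \<and> (\<forall>e>0. \<exists>M. \<forall>m\<ge>M. \<forall>n\<ge>M. nrm X (\<sigma> m \<ominus> \<sigma> n) < e)" for \<sigma>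
    by (auto simp: M.MCauchy_def ndist_def image_subset_iff)
  have 2: "limitin M.mtopology \<sigma> x sequentially \<longleftrightarrow>
       x \<in> carrier X \<and> (\<forall>e>0. \<exists>M. \<forall>n\<ge>M. nrm X (\<sigma> n \<ominus> x) < e)" if "\<forall>n. \<sigma> n \<in> carrier X" for \<sigma> x
    using that by (auto simp: M.limit_metric_sequentially ndist_def)
  show ?thesis
    unfolding M.mcomplete_def 1 by (simp add: 2 Bex_def cong: conj_cong imp_cong)
qed

end

lemma nvsI: "normed_space X \<Longrightarrow> nvs X"
  by (simp add: nvs_def)

section \<open>Bounded linear operators\<close>

locale nvs_pair = X: nvs X + Y: nvs Y
  for X :: "('k::{real_normed_field,banach}, 'a) nspace" (structure) and Y :: "('k, 'b) nspace" (structure)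
begin

lemma op_spaceD:
  assumes "T \<in> carrier (op_space X Y)"
  shows "T \<in> carrier X \<rightarrow>\<^sub>E carrier Y"
    and "\<And>x. x \<in> carrier X \<Longrightarrow> T x \<in> carrier Y"
    and "\<And>x y. x \<in> carrier X \<Longrightarrow> y \<in> carrier X \<Longrightarrow> T (x \<oplus>\<^bsub>X\<^esub> y) = T x \<oplus>\<^bsub>Y\<^esub> T y"
    and "\<And>c x. x \<in> carrier X \<Longrightarrow> T (c \<odot>\<^bsub>X\<^esub> x) = c \<odot>\<^bsub>Y\<^esub> T x"
    and "continuous_map (norm_topology X) (norm_topology Y) T"
  using assms by (auto simp: op_space_def)

lemma op_space_zero: "T \<in> carrier (op_space X Y) \<Longrightarrow> T \<zero>\<^bsub>X\<^esub> = \<zero>\<^bsub>Y\<^esub>"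
  using op_spaceD(4)[of T "\<zero>\<^bsub>X\<^esub>" 0] op_spaceD(2)[of T "\<zero>\<^bsub>X\<^esub>"] by simp

lemma op_space_bounded:
  assumes T: "T \<in> carrier (op_space X Y)"
  obtains C where "C > 0" "\<And>x. x \<in> carrier X \<Longrightarrow> nrm Y (T x) \<le> C * nrm X x"
proof -
  have "openin (norm_topology X) {x \<in> carrier X. T x \<in> {y \<in> carrier Y. nrm Y y < 1}}"
    using openin_continuous_map_preimage[OF op_spaceD(5)[OF T] Y.openin_unit_ball] by simp
  then obtain r where r: "r > 0" "\<And>x. x \<in> carrier X \<Longrightarrow> nrm X x < r \<Longrightarrow> nrm Y (T x) < 1"
    by (rule X.zero_neighbourhood) (auto simp: op_space_zero[OF T])
  show ?thesis
  proof (rule that[of "2 / r"])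
    fix x assume x: "x \<in> carrier X"
    show "nrm Y (T x) \<le> 2 / r * nrm X x"
    proof (cases "x = \<zero>\<^bsub>X\<^esub>")
      case True
      then show ?thesis by (simp add: op_space_zero[OF T])
    next
      case False
      then have pos: "nrm X x > 0" using x X.nrm_nonneg X.nrm_eq_0 by (metis less_eq_real_def)
      \<comment> \<open>This real scalar brings \<open>x\<close> to norm \<open>r / 2\<close>,
        inside the ball on which \<open>T\<close> has norm below 1; hence the constant
        \<open>2 / r\<close>.\<close>
      define c :: 'k where "c = of_real (r / (2 * nrm X x))"
      have nc: "norm c = r / (2 * nrm X x)" unfolding c_def norm_of_real using pos r by simp
      have "nrm X (c \<odot>\<^bsub>X\<^esub> x) < r"
        using x pos r by (simp add: nc)
      then have "nrm Y (T (c \<odot>\<^bsub>X\<^esub> x)) < 1" using r x by simp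
      then have "norm c * nrm Y (T x) < 1" using op_spaceD[OF T] x by simp
      then show ?thesis using pos r by (simp add: nc field_simps)
    qed
  qed (use r in simp)
qed

lemma op_nrm_set_bdd:
  assumes T: "T \<in> carrier (op_space X Y)"
  shows "bdd_above {nrm Y (T x) | x. x \<in> carrier X \<and> nrm X x \<le> 1}"
proof -
  obtain C where C: "C > 0" "\<And>x. x \<in> carrier X \<Longrightarrow> nrm Y (T x) \<le> C * nrm X x"
    using op_space_bounded[OF T] by blast
  have "nrm Y (T x) \<le> C" if "x \<in> carrier X" "nrm X x \<le> 1" for x
    using C(2)[OF that(1)] that C(1) by (smt (verit) mult_left_le)
  then show ?thesis by (intro bdd_aboveI[of _ C]) auto
qed

lemma nrm_op_space: "nrm (op_space X Y) T = Sup {nrm Y (T x) | x. x \<in> carrier X \<and> nrm X x \<le> 1}"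
  by (simp add: op_space_def)

lemma op_nrm_le:
  assumes "\<And>x. x \<in> carrier X \<Longrightarrow> nrm X x \<le> 1 \<Longrightarrow> nrm Y (T x) \<le> C"
  shows "nrm (op_space X Y) T \<le> C"
  unfolding nrm_op_space
proof (rule cSup_least)
  have "nrm Y (T \<zero>\<^bsub>X\<^esub>) \<in> {nrm Y (T x) | x. x \<in> carrier X \<and> nrm X x \<le> 1}"
    by (rule CollectI, rule exI[of _ "\<zero>\<^bsub>X\<^esub>"]) simp
  then show "{nrm Y (T x) | x. x \<in> carrier X \<and> nrm X x \<le> 1} \<noteq> {}" by blast
qed (use assms in auto)

lemma op_nrm_ge:
  assumes T: "T \<in> carrier (op_space X Y)" and x: "x \<in> carrier X" "nrm X x \<le> 1"
  shows "nrm Y (T x) \<le> nrm (op_space X Y) T"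
  unfolding nrm_op_space by (rule cSup_upper[OF _ op_nrm_set_bdd[OF T]]) (use x in auto)

lemma op_nrm_nonneg: "T \<in> carrier (op_space X Y) \<Longrightarrow> 0 \<le> nrm (op_space X Y) T"
  using op_nrm_ge[of T "\<zero>\<^bsub>X\<^esub>"] by (simp add: op_space_zero)

lemma op_nrm:
  assumes T: "T \<in> carrier (op_space X Y)" and x: "x \<in> carrier X"
  shows "nrm Y (T x) \<le> nrm (op_space X Y) T * nrm X x"
proof (cases "x = \<zero>\<^bsub>X\<^esub>")
  case True
  then show ?thesis by (simp add: op_space_zero[OF T])
next
  case False
  then have pos: "nrm X x > 0" using x X.nrm_nonneg X.nrm_eq_0 by (metis less_eq_real_def)
  define c :: 'k where "c = of_real (inverse (nrm X x))"
  have nc: "norm c = inverse (nrm X x)" unfolding c_def norm_of_real using pos by simp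
  have "nrm Y (T (c \<odot>\<^bsub>X\<^esub> x)) \<le> nrm (op_space X Y) T"
    by (rule op_nrm_ge[OF T]) (use x pos in \<open>simp_all add: nc del: X.nrm_eq_0\<close>)
  then have "inverse (nrm X x) * nrm Y (T x) \<le> nrm (op_space X Y) T"
    using op_spaceD[OF T] x by (simp add: nc)
  then show ?thesis using pos by (simp add: field_simps)
qed

text \<open>Linearity turns the bound into a Lipschitz estimate, so the preimage of an open set
  contains a ball of radius \<open>r / D\<close> about each of its points.\<close>

lemma op_spaceI:
  assumes T: "T \<in> carrier X \<rightarrow>\<^sub>E carrier Y"
    and add: "\<And>x y. x \<in> carrier X \<Longrightarrow> y \<in> carrier X \<Longrightarrow> T (x \<oplus>\<^bsub>X\<^esub> y) = T x \<oplus>\<^bsub>Y\<^esub> T y"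
    and smult: "\<And>c x. x \<in> carrier X \<Longrightarrow> T (c \<odot>\<^bsub>X\<^esub> x) = c \<odot>\<^bsub>Y\<^esub> T x"
    and bound: "\<And>x. x \<in> carrier X \<Longrightarrow> nrm Y (T x) \<le> C * nrm X x"
  shows "T \<in> carrier (op_space X Y)"
proof -
  have T': "T x \<in> carrier Y" if "x \<in> carrier X" for x using T that by auto
  have minus: "T (x \<ominus>\<^bsub>X\<^esub> y) = T x \<ominus>\<^bsub>Y\<^esub> T y" if x: "x \<in> carrier X" and y: "y \<in> carrier X" for x y
    using add[OF x, of "\<ominus>\<^bsub>X\<^esub> y"] smult[OF y] T'[OF y] y
    by (simp add: a_minus_def X.minus_eq_smult[OF y] Y.minus_eq_smult)
  interpret MX: Metric_space "carrier X" "ndist X" by (rule X.Metric_space)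
  interpret MY: Metric_space "carrier Y" "ndist Y" by (rule Y.Metric_space)
  \<comment> \<open>The added 1 makes the Lipschitz constant positive, so that \<open>r / D\<close>
    is a radius whatever the sign of \<open>C\<close>.\<close>
  define D where "D = \<bar>C\<bar> + 1"
  have D: "D > 0" "\<And>x. x \<in> carrier X \<Longrightarrow> nrm Y (T x) \<le> D * nrm X x"
    using bound by (auto simp: D_def intro!: order_trans[OF bound mult_right_mono])
  have "continuous_map (norm_topology X) (norm_topology Y) T"
    unfolding continuous_map_def X.topspace_norm_topology Y.topspace_norm_topology
  proof (intro conjI allI impI)
    show "T \<in> carrier X \<rightarrow> carrier Y" using T by auto
    fix V assume "openin (norm_topology Y) V"
    then have V: "V \<subseteq> carrier Y" "\<And>y. y \<in> V \<Longrightarrow> \<exists>r>0. MY.mball y r \<subseteq> V"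
      by (auto simp: norm_topology_def MY.openin_mtopology)
    have "\<exists>r>0. MX.mball x r \<subseteq> {x \<in> carrier X. T x \<in> V}" if x: "x \<in> carrier X" "T x \<in> V" for x
    proof -
      obtain r where r: "r > 0" "MY.mball (T x) r \<subseteq> V" using V(2) x by blast
      have "T y \<in> V" if y: "y \<in> carrier X" "ndist X x y < r / D" for y
      proof -
        have "nrm X (x \<ominus>\<^bsub>X\<^esub> y) < r / D" using that x by (simp add: ndist_def)
        then have "D * nrm X (x \<ominus>\<^bsub>X\<^esub> y) < r" using D(1) by (simp add: field_simps)
        moreover have "nrm Y (T (x \<ominus>\<^bsub>X\<^esub> y)) \<le> D * nrm X (x \<ominus>\<^bsub>X\<^esub> y)" using D x y by simp
        ultimately have "ndist Y (T x) (T y) < r"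
          using x y T' by (simp add: ndist_def minus)
        then show ?thesis using r x y T' by auto
      qed
      then show ?thesis using r D x by (intro exI[of _ "r / D"]) auto
    qed
    then show "openin (norm_topology X) {x \<in> carrier X. T x \<in> V}"
      by (auto simp: norm_topology_def MX.openin_mtopology)
  qed
  then show ?thesis using T add smult by (simp add: op_space_def)
qed

lemma op_space_simps:
  "\<zero>\<^bsub>op_space X Y\<^esub> = (\<lambda>x\<in>carrier X. \<zero>\<^bsub>Y\<^esub>)"
  "S \<oplus>\<^bsub>op_space X Y\<^esub> T = (\<lambda>x\<in>carrier X. S x \<oplus>\<^bsub>Y\<^esub> T x)"
  "c \<odot>\<^bsub>op_space X Y\<^esub> T = (\<lambda>x\<in>carrier X. c \<odot>\<^bsub>Y\<^esub> T x)"
  by (simp_all add: op_space_def)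

lemma op_zero_closed: "\<zero>\<^bsub>op_space X Y\<^esub> \<in> carrier (op_space X Y)"
  by (rule op_spaceI[of _ 0]) (auto simp: op_space_simps)

lemma op_add_closed:
  assumes S: "S \<in> carrier (op_space X Y)" and T: "T \<in> carrier (op_space X Y)"
  shows "S \<oplus>\<^bsub>op_space X Y\<^esub> T \<in> carrier (op_space X Y)"
proof (rule op_spaceI[of _ "nrm (op_space X Y) S + nrm (op_space X Y) T"], goal_cases)
  case (2 x y)
  then show ?case
    using op_spaceD(2,3)[OF S] op_spaceD(2,3)[OF T] by (simp add: op_space_simps Y.M.add.m_ac)
next
  case (4 x)
  have "nrm Y (S x \<oplus>\<^bsub>Y\<^esub> T x) \<le> nrm Y (S x) + nrm Y (T x)"
    using 4 op_spaceD(2)[OF S] op_spaceD(2)[OF T] Y.nrm_add by simp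
  then show ?case using op_nrm[OF S 4] op_nrm[OF T 4] 4
    by (simp add: op_space_simps distrib_right)
qed (use op_spaceD(2,4)[OF S] op_spaceD(2,4)[OF T] in \<open>auto simp: op_space_simps Y.smult_add_right\<close>)

lemma op_smult_closed:
  assumes S: "S \<in> carrier (op_space X Y)"
  shows "c \<odot>\<^bsub>op_space X Y\<^esub> S \<in> carrier (op_space X Y)"
proof (rule op_spaceI[of _ "norm c * nrm (op_space X Y) S"], goal_cases)
  case (4 x)
  then show ?case using mult_left_mono[OF op_nrm[OF S 4], of "norm c"] op_spaceD(2)[OF S]
    by (simp add: op_space_simps mult.assoc)
qed (use op_spaceD(2,3,4)[OF S] in \<open>auto simp: op_space_simps Y.smult_add_right Y.smult_smult mult.commute\<close>)

text \<open>With \<open>scalars\<close> as target, applied to a space and then to its dual, this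
  makes duals and biduals normed spaces. Every law is checked pointwise, because extensional
  mappings that agree on the carrier are equal.\<close>

lemma normed_space_op_space: "normed_space (op_space X Y)"
proof -
  let ?O = "op_space X Y"
  note D = op_spaceD(1,2)
  have eqI: "S = T" if "S \<in> carrier ?O" "T \<in> carrier ?O" "\<And>x. x \<in> carrier X \<Longrightarrow> S x = T x" for S T
    by (rule PiE_ext[OF D(1)[OF that(1)] D(1)[OF that(2)]]) (use that in auto)
  have "abelian_group ?O"
  proof (rule abelian_groupI)
    fix S T R assume S: "S \<in> carrier ?O" and T: "T \<in> carrier ?O" and R: "R \<in> carrier ?O"
    show "S \<oplus>\<^bsub>?O\<^esub> T \<oplus>\<^bsub>?O\<^esub> R = S \<oplus>\<^bsub>?O\<^esub> (T \<oplus>\<^bsub>?O\<^esub> R)"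
      by (rule eqI) (use S T R D(2)[OF S] D(2)[OF T] D(2)[OF R] in \<open>auto intro!: op_add_closed\<close>,
          auto simp: op_space_simps Y.M.add.m_ac)
  next
    fix S T assume S: "S \<in> carrier ?O" and T: "T \<in> carrier ?O"
    show "S \<oplus>\<^bsub>?O\<^esub> T = T \<oplus>\<^bsub>?O\<^esub> S"
      by (rule eqI) (use S T D(2)[OF S] D(2)[OF T] in \<open>auto intro!: op_add_closed\<close>,
          auto simp: op_space_simps Y.M.add.m_ac)
  next
    fix S assume S: "S \<in> carrier ?O"
    show "\<zero>\<^bsub>?O\<^esub> \<oplus>\<^bsub>?O\<^esub> S = S"
      by (rule eqI) (use S D(2)[OF S] in \<open>auto intro!: op_add_closed op_zero_closed\<close>, auto simp: op_space_simps)
    have "(-1) \<odot>\<^bsub>?O\<^esub> S \<oplus>\<^bsub>?O\<^esub> S = \<zero>\<^bsub>?O\<^esub>"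
      by (rule eqI) (use S D(2)[OF S] in \<open>auto intro!: op_add_closed op_smult_closed op_zero_closed\<close>,
          auto simp: op_space_simps Y.minus_eq_smult[symmetric] Y.M.l_neg)
    then show "\<exists>T\<in>carrier ?O. T \<oplus>\<^bsub>?O\<^esub> S = \<zero>\<^bsub>?O\<^esub>"
      using op_smult_closed[OF S] by blast
  qed (auto intro: op_add_closed op_zero_closed)
  then have "Module.module scalars ?O"
  proof (rule moduleI[OF cring_scalars])
    fix a b :: 'k and S T assume S: "S \<in> carrier ?O" and T: "T \<in> carrier ?O"
    show "a \<odot>\<^bsub>?O\<^esub> (S \<oplus>\<^bsub>?O\<^esub> T) = a \<odot>\<^bsub>?O\<^esub> S \<oplus>\<^bsub>?O\<^esub> a \<odot>\<^bsub>?O\<^esub> T"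
      by (rule eqI) (use S T D(2)[OF S] D(2)[OF T] in \<open>auto intro!: op_add_closed op_smult_closed\<close>,
          auto simp: op_space_simps Y.smult_add_right)
  next
    fix a b :: 'k and S assume S: "S \<in> carrier ?O"
    show "a \<odot>\<^bsub>?O\<^esub> S \<in> carrier ?O" using S by (rule op_smult_closed)
    show "(a \<oplus>\<^bsub>scalars\<^esub> b) \<odot>\<^bsub>?O\<^esub> S = a \<odot>\<^bsub>?O\<^esub> S \<oplus>\<^bsub>?O\<^esub> b \<odot>\<^bsub>?O\<^esub> S"
      by (rule eqI) (use S D(2)[OF S] in \<open>auto intro!: op_add_closed op_smult_closed\<close>,
          auto simp: op_space_simps Y.smult_add_left)
    show "(a \<otimes>\<^bsub>scalars\<^esub> b) \<odot>\<^bsub>?O\<^esub> S = a \<odot>\<^bsub>?O\<^esub> (b \<odot>\<^bsub>?O\<^esub> S)"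
      by (rule eqI) (use S D(2)[OF S] in \<open>auto intro!: op_add_closed op_smult_closed\<close>,
          auto simp: op_space_simps Y.smult_smult)
    show "\<one>\<^bsub>scalars\<^esub> \<odot>\<^bsub>?O\<^esub> S = S"
      by (rule eqI) (use S D(2)[OF S] in \<open>auto intro!: op_add_closed op_smult_closed[of _ 1, simplified]\<close>,
          auto simp: op_space_simps)
  qed
  moreover have "nrm ?O S = 0 \<longleftrightarrow> S = \<zero>\<^bsub>?O\<^esub>" if S: "S \<in> carrier ?O" for S
  proof
    assume 0: "nrm ?O S = 0"
    show "S = \<zero>\<^bsub>?O\<^esub>"
    proof (rule eqI[OF S op_zero_closed])
      fix x assume x: "x \<in> carrier X"
      then have "nrm Y (S x) = 0"
        using op_nrm[OF S x] 0 D(2)[OF S x] Y.nrm_nonneg by (metis mult_zero_left order_antisym)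
      then show "S x = \<zero>\<^bsub>?O\<^esub> x" using x D(2)[OF S x] by (simp add: op_space_simps)
    qed
  next
    assume "S = \<zero>\<^bsub>?O\<^esub>"
    then have "nrm ?O S \<le> 0" by (intro op_nrm_le) (simp add: op_space_simps)
    then show "nrm ?O S = 0" using op_nrm_nonneg[OF S] by simp
  qed
  moreover have le: "nrm ?O (c \<odot>\<^bsub>?O\<^esub> S) \<le> norm c * nrm ?O S" if S: "S \<in> carrier ?O" for c S
    by (rule op_nrm_le) (use D(2)[OF S] in \<open>auto simp: op_space_simps intro!: mult_left_mono op_nrm_ge[OF S]\<close>)
  moreover have "nrm ?O (c \<odot>\<^bsub>?O\<^esub> S) = norm c * nrm ?O S" if S: "S \<in> carrier ?O" for c S
  proof (cases "c = 0")
    case True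
    have "nrm ?O (c \<odot>\<^bsub>?O\<^esub> S) \<ge> 0" using op_nrm_nonneg op_smult_closed[OF S] by blast
    then show ?thesis using True le[OF S, of c] by simp
  next
    case False
    \<comment> \<open>Scaling back by \<open>inverse c\<close> and using the inequality already
      proved gives the reverse inequality.\<close>
    have "inverse c \<odot>\<^bsub>?O\<^esub> (c \<odot>\<^bsub>?O\<^esub> S) = S"
      by (rule eqI) (use S D(2)[OF S] False in \<open>auto intro!: op_smult_closed\<close>, auto simp: op_space_simps Y.smult_smult)
    then have "nrm ?O S \<le> inverse (norm c) * nrm ?O (c \<odot>\<^bsub>?O\<^esub> S)"
      using le[OF op_smult_closed[OF S, of c], of "inverse c"] by (simp add: norm_inverse)
    then have "norm c * nrm ?O S \<le> nrm ?O (c \<odot>\<^bsub>?O\<^esub> S)"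
      using False by (simp add: field_simps)
    then show ?thesis using le[OF S, of c] by simp
  qed
  moreover have "nrm ?O (S \<oplus>\<^bsub>?O\<^esub> T) \<le> nrm ?O S + nrm ?O T" if S: "S \<in> carrier ?O" and T: "T \<in> carrier ?O" for S T
    by (rule op_nrm_le) (use D(2)[OF S] D(2)[OF T] in
        \<open>auto simp: op_space_simps intro!: Y.nrm_add[THEN order_trans] add_mono op_nrm_ge[OF S] op_nrm_ge[OF T]\<close>)
  ultimately show ?thesis
    using op_nrm_nonneg by (auto simp: normed_space_def)
qed

end

section \<open>Duals, biduals and the canonical embedding\<close>

lemma nvs_scalars: "nvs (scalars :: ('k::{real_normed_field,banach}, 'k) nspace)"
  by (rule nvsI[OF normed_space_scalars])

lemma nvs_pair_scalars: "nvs X \<Longrightarrow> nvs_pair X scalars"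
  by (simp add: nvs_pair_def nvs_scalars)

lemma nvs_dual: "nvs X \<Longrightarrow> nvs (dual X)"
  unfolding dual_def using nvs_pair.normed_space_op_space[OF nvs_pair_scalars] by (rule nvsI)

context nvs
begin

interpretation S: nvs_pair X scalars
  by (rule nvs_pair_scalars) unfold_locales

lemma dualD:
  assumes "f \<in> carrier (dual X)"
  shows "f \<in> extensional (carrier X)"
    and "\<And>x y. x \<in> carrier X \<Longrightarrow> y \<in> carrier X \<Longrightarrow> f (x \<oplus> y) = f x + f y"
    and "\<And>c x. x \<in> carrier X \<Longrightarrow> f (c \<odot> x) = c * f x"
    and "\<And>x. x \<in> carrier X \<Longrightarrow> norm (f x) \<le> nrm (dual X) f * nrm X x"
  using S.op_spaceD[of f] S.op_nrm[of f] assms by (auto simp: dual_def PiE_def)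

lemma dualI:
  assumes "f \<in> extensional (carrier X)"
    and "\<And>x y. x \<in> carrier X \<Longrightarrow> y \<in> carrier X \<Longrightarrow> f (x \<oplus> y) = f x + f y"
    and "\<And>c x. x \<in> carrier X \<Longrightarrow> f (c \<odot> x) = c * f x"
    and "\<And>x. x \<in> carrier X \<Longrightarrow> norm (f x) \<le> C * nrm X x"
  shows "f \<in> carrier (dual X)"
  using S.op_spaceI[of f C] assms by (auto simp: dual_def PiE_def)

lemma dual_nrm_le:
  "(\<And>x. x \<in> carrier X \<Longrightarrow> nrm X x \<le> 1 \<Longrightarrow> norm (f x) \<le> C) \<Longrightarrow> nrm (dual X) f \<le> C"
  using S.op_nrm_le[of f C] by (simp add: dual_def)

lemma dual_nrm_le':
  assumes "\<And>x. x \<in> carrier X \<Longrightarrow> norm (f x) \<le> C * nrm X x" "C \<ge> 0"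
  shows "nrm (dual X) f \<le> C"
  by (rule dual_nrm_le) (use assms in \<open>meson mult_left_le order_trans\<close>)

lemma dual_nrm_nonneg: "f \<in> carrier (dual X) \<Longrightarrow> 0 \<le> nrm (dual X) f"
  using S.op_nrm_nonneg by (simp add: dual_def)

lemma dual_simps:
  "\<zero>\<^bsub>dual X\<^esub> = (\<lambda>x\<in>carrier X. 0)"
  "f \<oplus>\<^bsub>dual X\<^esub> g = (\<lambda>x\<in>carrier X. f x + g x)"
  "c \<odot>\<^bsub>dual X\<^esub> g = (\<lambda>x\<in>carrier X. c * g x)"
  by (simp_all add: dual_def S.op_space_simps)

lemma dual_minus:
  assumes "f \<in> carrier (dual X)" "g \<in> carrier (dual X)" "x \<in> carrier X"
  shows "(f \<ominus>\<^bsub>dual X\<^esub> g) x = f x - g x"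
proof -
  interpret D: nvs "dual X" by (rule nvs_dual) unfold_locales
  show ?thesis
    using assms by (simp add: a_minus_def D.minus_eq_smult dual_simps)
qed

lemma canon_closed: "x \<in> carrier X \<Longrightarrow> canon X x \<in> carrier (bidual X)"
proof -
  assume x: "x \<in> carrier X"
  interpret D: nvs "dual X" by (rule nvs_dual) unfold_locales
  show ?thesis
  proof (rule D.dualI[of _ "nrm X x"])
    fix f assume f: "f \<in> carrier (dual X)"
    show "norm (canon X x f) \<le> nrm X x * nrm (dual X) f"
      using dualD(4)[OF f x] f by (simp add: canon_def mult.commute)
    show "canon X x (c \<odot>\<^bsub>dual X\<^esub> f) = c * canon X x f" for c
      using D.smult_in[OF f, of c] f x by (simp add: canon_def dual_simps)
    show "canon X x (f \<oplus>\<^bsub>dual X\<^esub> g) = canon X x f + canon X x g" if g: "g \<in> carrier (dual X)" for g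
      using D.add_in[OF f g] f g x by (simp add: canon_def dual_simps)
  qed (simp add: canon_def)
qed

end

section \<open>Multilinear mappings\<close>

lemma tuple_upd: "x \<in> tuples N X \<Longrightarrow> j < N \<Longrightarrow> t \<in> carrier (X j) \<Longrightarrow> x(j := t) \<in> tuples N X"
  by (auto simp: PiE_def extensional_def Pi_def)

lemma multilin_spaceD:
  assumes "\<Phi> \<in> carrier (multilin_space N X Y)"
  shows "\<Phi> \<in> extensional (tuples N X)"
    and "\<And>x. x \<in> tuples N X \<Longrightarrow> \<Phi> x \<in> carrier Y"
    and "\<And>j x s t. j < N \<Longrightarrow> x \<in> tuples N X \<Longrightarrow> s \<in> carrier (X j) \<Longrightarrow> t \<in> carrier (X j) \<Longrightarrow>
           \<Phi> (x(j := s \<oplus>\<^bsub>X j\<^esub> t)) = \<Phi> (x(j := s)) \<oplus>\<^bsub>Y\<^esub> \<Phi> (x(j := t))"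
    and "\<And>j x c s. j < N \<Longrightarrow> x \<in> tuples N X \<Longrightarrow> s \<in> carrier (X j) \<Longrightarrow>
           \<Phi> (x(j := c \<odot>\<^bsub>X j\<^esub> s)) = c \<odot>\<^bsub>Y\<^esub> \<Phi> (x(j := s))"
    and "continuous_map (product_topology (\<lambda>j. norm_topology (X j)) {..<N}) (norm_topology Y) \<Phi>"
  using assms by (auto simp: multilin_space_def PiE_def)

locale nvs_tuple = Y: nvs Y
  for N :: nat and X :: "nat \<Rightarrow> ('k::{real_normed_field,banach}, 'a) nspace" and Y :: "('k, 'b) nspace" +
  assumes nvs_X: "\<And>j. j < N \<Longrightarrow> nvs (X j)"
begin

text \<open>Homogeneity is used one coordinate at a time: in the induction the first
  \<open>n\<close> coordinates are scaled and the others are unchanged.\<close>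

lemma multilin_scale:
  assumes \<Phi>: "\<Phi> \<in> carrier (multilin_space N X Y)" and x: "x \<in> tuples N X"
  shows "\<Phi> (\<lambda>j\<in>{..<N}. c j \<odot>\<^bsub>X j\<^esub> x j) = (\<Prod>j<N. c j) \<odot>\<^bsub>Y\<^esub> \<Phi> x"
proof -
  have "\<Phi> (\<lambda>j\<in>{..<N}. if j < n then c j \<odot>\<^bsub>X j\<^esub> x j else x j) = (\<Prod>j<n. c j) \<odot>\<^bsub>Y\<^esub> \<Phi> x" if "n \<le> N" for n
    using that
  proof (induction n)
    case 0
    have "(\<lambda>j\<in>{..<N}. x j) = x" using x by (auto simp: PiE_def extensional_restrict)
    then show ?case using multilin_spaceD(2)[OF \<Phi> x] by simp
  next
    case (Suc n)
    let ?y = "\<lambda>n. \<lambda>j\<in>{..<N}. if j < n then c j \<odot>\<^bsub>X j\<^esub> x j else x j"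
    have n: "n < N" using Suc.prems by simp
    then have xn: "x n \<in> carrier (X n)" using PiE_mem[OF x] by simp
    have y: "?y n \<in> tuples N X"
    proof (intro restrict_PiE_iff[THEN iffD2] ballI)
      fix j assume "j \<in> {..<N}"
      then have "x j \<in> carrier (X j)" "c j \<odot>\<^bsub>X j\<^esub> x j \<in> carrier (X j)"
        using PiE_mem[OF x] nvs.smult_in[OF nvs_X] by simp_all
      then show "(if j < n then c j \<odot>\<^bsub>X j\<^esub> x j else x j) \<in> carrier (X j)" by simp
    qed
    have e1: "?y (Suc n) = (?y n)(n := c n \<odot>\<^bsub>X n\<^esub> x n)"
      using n by (simp add: fun_eq_iff less_Suc_eq)
    have e2: "(?y n)(n := x n) = ?y n" using n by (simp add: fun_eq_iff)
    have "\<Phi> (?y (Suc n)) = c n \<odot>\<^bsub>Y\<^esub> \<Phi> (?y n)"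
      by (simp only: e1 multilin_spaceD(4)[OF \<Phi> n y xn] e2)
    moreover have "\<Phi> (?y n) = (\<Prod>j<n. c j) \<odot>\<^bsub>Y\<^esub> \<Phi> x" by (rule Suc.IH) (use n in simp)
    ultimately show ?case
      using Y.smult_smult[OF multilin_spaceD(2)[OF \<Phi> x], of "c n" "\<Prod>j<n. c j"]
      by (simp only: prod.lessThan_Suc mult.commute[of _ "c n"])
  qed
  moreover have "(\<lambda>j\<in>{..<N}. c j \<odot>\<^bsub>X j\<^esub> x j) = (\<lambda>j\<in>{..<N}. if j < N then c j \<odot>\<^bsub>X j\<^esub> x j else x j)"
    by (rule restrict_ext) simp
  ultimately show ?thesis by simp
qed

lemma multilin_zero:
  assumes \<Phi>: "\<Phi> \<in> carrier (multilin_space N X Y)" and x: "x \<in> tuples N X"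
    and j: "j < N" "x j = \<zero>\<^bsub>X j\<^esub>"
  shows "\<Phi> x = \<zero>\<^bsub>Y\<^esub>"
proof -
  interpret Xj: nvs "X j" by (rule nvs_X[OF j(1)])
  have "x = x(j := 0 \<odot>\<^bsub>X j\<^esub> \<zero>\<^bsub>X j\<^esub>)" using j by (auto simp: fun_eq_iff)
  then have "\<Phi> x = 0 \<odot>\<^bsub>Y\<^esub> \<Phi> (x(j := \<zero>\<^bsub>X j\<^esub>))"
    using multilin_spaceD(4)[OF \<Phi> j(1) x, of "\<zero>\<^bsub>X j\<^esub>" 0] by simp
  then show ?thesis using multilin_spaceD(2)[OF \<Phi> tuple_upd[OF x j(1)]] by simp
qed

text \<open>Continuity at the zero tuple gives a product of balls on which \<Phi> has norm below 1;
  scaling each coordinate into its own ball gives the product bound. The assumption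
  \<open>N > 0\<close> makes \<Phi> vanish at the zero tuple.\<close>

lemma multilin_bounded:
  assumes \<Phi>: "\<Phi> \<in> carrier (multilin_space N X Y)" and N: "N > 0"
  obtains C where "C > 0" "\<And>x. x \<in> tuples N X \<Longrightarrow> nrm Y (\<Phi> x) \<le> C * (\<Prod>j<N. nrm (X j) (x j))"
proof -
  let ?T = "product_topology (\<lambda>j. norm_topology (X j)) {..<N}"
  define z where "z = (\<lambda>j\<in>{..<N}. \<zero>\<^bsub>X j\<^esub>)"
  have z: "z \<in> tuples N X"
    unfolding z_def using nvs.zero_in[OF nvs_X] by auto
  have tops: "topspace ?T = tuples N X"
    unfolding topspace_product_topology by (rule PiE_cong) (simp add: nvs.topspace_norm_topology nvs_X)
  have "openin ?T {x \<in> tuples N X. \<Phi> x \<in> {y \<in> carrier Y. nrm Y y < 1}}"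
    using openin_continuous_map_preimage[OF multilin_spaceD(5)[OF \<Phi>] Y.openin_unit_ball] tops by simp
  moreover have "z \<in> {x \<in> tuples N X. \<Phi> x \<in> {y \<in> carrier Y. nrm Y y < 1}}"
    using z multilin_zero[OF \<Phi> z N] N by (auto simp: z_def)
  ultimately obtain U where U: "\<And>j. j < N \<Longrightarrow> openin (norm_topology (X j)) (U j)" "z \<in> Pi\<^sub>E {..<N} U"
    "Pi\<^sub>E {..<N} U \<subseteq> {x \<in> tuples N X. \<Phi> x \<in> {y \<in> carrier Y. nrm Y y < 1}}"
    unfolding openin_product_topology_alt by (metis (no_types, lifting) lessThan_iff)
  have "\<exists>r>0. \<forall>x. x \<in> carrier (X j) \<longrightarrow> nrm (X j) x < r \<longrightarrow> x \<in> U j" if j: "j < N" for j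
    by (rule nvs.zero_neighbourhood[OF nvs_X[OF j] U(1)[OF j]]) (use U(2) j in \<open>auto simp: z_def\<close>)
  then obtain r where r: "\<And>j. j < N \<Longrightarrow> r j > 0"
    "\<And>j x. j < N \<Longrightarrow> x \<in> carrier (X j) \<Longrightarrow> nrm (X j) x < r j \<Longrightarrow> x \<in> U j"
    by metis
  show ?thesis
  proof (rule that[of "\<Prod>j<N. 2 / r j"])
    show "0 < (\<Prod>j<N. 2 / r j)" by (intro prod_pos) (use r in auto)
    fix x assume x: "x \<in> tuples N X"
    have xj: "x j \<in> carrier (X j)" if "j < N" for j using x that by auto
    show "nrm Y (\<Phi> x) \<le> (\<Prod>j<N. 2 / r j) * (\<Prod>j<N. nrm (X j) (x j))"
    proof (cases "\<exists>j<N. x j = \<zero>\<^bsub>X j\<^esub>")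
      case True
      then have "\<Phi> x = \<zero>\<^bsub>Y\<^esub>" using multilin_zero[OF \<Phi> x] by blast
      moreover have "0 \<le> (\<Prod>j<N. 2 / r j) * (\<Prod>j<N. nrm (X j) (x j))"
        by (intro mult_nonneg_nonneg prod_nonneg) (use r xj nvs.nrm_nonneg[OF nvs_X] in \<open>auto intro: less_imp_le\<close>)
      ultimately show ?thesis by simp
    next
      case False
      have pos: "nrm (X j) (x j) > 0" if j: "j < N" for j
        using nvs.nrm_nonneg[OF nvs_X[OF j] xj[OF j]] nvs.nrm_eq_0[OF nvs_X[OF j] xj[OF j]] False j by force
      \<comment> \<open>Coordinate \<open>j\<close> is scaled to norm \<open>r j / 2\<close>, which
        requires nonzero coordinates; a tuple with a zero coordinate is mapped to zero and was
        treated before.\<close>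
      define c :: "nat \<Rightarrow> 'k" where "c j = of_real (r j / (2 * nrm (X j) (x j)))" for j
      have nc: "norm (c j) = r j / (2 * nrm (X j) (x j))" if "j < N" for j
        unfolding c_def norm_of_real using pos[OF that] r(1)[OF that] by simp
      have "(\<lambda>j\<in>{..<N}. c j \<odot>\<^bsub>X j\<^esub> x j) \<in> Pi\<^sub>E {..<N} U"
      proof (intro restrict_PiE_iff[THEN iffD2] ballI)
        fix j assume "j \<in> {..<N}"
        then have j: "j < N" by simp
        show "c j \<odot>\<^bsub>X j\<^esub> x j \<in> U j"
          by (rule r(2)[OF j]) (use pos[OF j] r(1)[OF j] xj[OF j] nvs.smult_in[OF nvs_X[OF j]] nvs.nrm_smult[OF nvs_X[OF j]] nc[OF j] in auto)
      qed
      then have "nrm Y (\<Phi> (\<lambda>j\<in>{..<N}. c j \<odot>\<^bsub>X j\<^esub> x j)) < 1"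
        using subsetD[OF U(3)] by blast
      then have "(\<Prod>j<N. norm (c j)) * nrm Y (\<Phi> x) < 1"
        using multilin_scale[OF \<Phi> x, of c] multilin_spaceD(2)[OF \<Phi> x] by (simp add: prod_norm)
      moreover have "(\<Prod>j<N. norm (c j)) * ((\<Prod>j<N. 2 / r j) * (\<Prod>j<N. nrm (X j) (x j))) = 1"
      proof -
        have "norm (c j) * (2 / r j * nrm (X j) (x j)) = 1" if "j < N" for j
          using nc[OF that] pos[OF that] r(1)[OF that] by simp
        then have "(\<Prod>j<N. norm (c j) * (2 / r j * nrm (X j) (x j)))= 1" by (intro prod.neutral ballI) (simp only: lessThan_iff)
        then show ?thesis by (simp only: prod.distrib)
      qed
      moreover have "(\<Prod>j<N. norm (c j)) > 0"
        by (intro prod_pos) (use nc pos r in auto)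
      ultimately show ?thesis
        by (smt (verit) mult_less_cancel_left_pos)
    qed
  qed
qed

lemma nrm_multilin_space:
  "nrm (multilin_space N X Y) \<Phi> =
     Sup {nrm Y (\<Phi> x) | x. x \<in> tuples N X \<and> (\<forall>j<N. nrm (X j) (x j) \<le> 1)}"
  by (simp add: multilin_space_def)

text \<open>The supremum defining the norm dominates each value only over a set bounded above, which
  \<open>multilin_bounded\<close> supplies.\<close>

lemma multilin_nrm_ge:
  assumes \<Phi>: "\<Phi> \<in> carrier (multilin_space N X Y)" and N: "N > 0"
    and x: "x \<in> tuples N X" "\<And>j. j < N \<Longrightarrow> nrm (X j) (x j) \<le> 1"
  shows "nrm Y (\<Phi> x) \<le> nrm (multilin_space N X Y) \<Phi>"
proof -
  obtain C where C: "C > 0" "\<And>x. x \<in> tuples N X \<Longrightarrow> nrm Y (\<Phi> x) \<le> C * (\<Prod>j<N. nrm (X j) (x j))"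
    using multilin_bounded[OF \<Phi> N] by blast
  have "nrm Y (\<Phi> x) \<le> C" if "x \<in> tuples N X" "\<forall>j<N. nrm (X j) (x j) \<le> 1" for x
  proof -
    have "(\<Prod>j<N. nrm (X j) (x j)) \<le> 1"
      by (rule prod_le_1) (use that nvs.nrm_nonneg[OF nvs_X] in auto)
    then show ?thesis using C(2)[OF that(1)] C(1) by (smt (verit) mult_left_le)
  qed
  then have "bdd_above {nrm Y (\<Phi> x) | x. x \<in> tuples N X \<and> (\<forall>j<N. nrm (X j) (x j) \<le> 1)}"
    by (intro bdd_aboveI[of _ C]) auto
  then show ?thesis
    unfolding nrm_multilin_space by (rule cSup_upper[rotated]) (use x in auto)
qed

end

section \<open>Copies, the scalar field and \<open>l\<^sub>1\<close>\<close>

lemma copy_space_simps [simp]: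
  "carrier (copy_space f g X) = f ` carrier X" "\<zero>\<^bsub>copy_space f g X\<^esub> = f \<zero>\<^bsub>X\<^esub>"
  "x \<oplus>\<^bsub>copy_space f g X\<^esub> y = f (g x \<oplus>\<^bsub>X\<^esub> g y)" "c \<odot>\<^bsub>copy_space f g X\<^esub> x = f (c \<odot>\<^bsub>X\<^esub> g x)"
  "nrm (copy_space f g X) x = nrm X (g x)"
  by (simp_all add: copy_space_def)

context nvs
begin

context
  fixes f :: "'a \<Rightarrow> 'b" and g
  assumes gf: "\<And>x. g (f x) = x"
begin

lemma normed_space_copy: "normed_space (copy_space f g X)"
proof -
  have inj: "f x = f y \<longleftrightarrow> x = y" for x y using gf by metis
  have "abelian_group (copy_space f g X)"
  proof (rule abelian_groupI)
    fix x assume "x \<in> carrier (copy_space f g X)"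
    then show "\<exists>y\<in>carrier (copy_space f g X). y \<oplus>\<^bsub>copy_space f g X\<^esub> x = \<zero>\<^bsub>copy_space f g X\<^esub>"
      by (auto simp: gf inj M.l_neg intro!: bexI[of _ "\<ominus> g x"])
  qed (auto simp: gf M.add.m_ac)
  then have "Module.module scalars (copy_space f g X)"
    by (rule moduleI[OF cring_scalars]) (auto simp: gf smult_add_left smult_add_right smult_smult)
  then show ?thesis
    by (auto simp: normed_space_def gf inj nrm_add)
qed

lemma copy_minus:
  assumes "x \<in> carrier X" "y \<in> carrier X"
  shows "f x \<ominus>\<^bsub>copy_space f g X\<^esub> f y = f (x \<ominus> y)"
proof -
  interpret C: nvs "copy_space f g X" by (rule nvsI[OF normed_space_copy])
  have "f y \<in> carrier (copy_space f g X)" using assms by simp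
  then show ?thesis
    unfolding a_minus_def by (subst C.minus_eq_smult) (use assms in \<open>simp_all add: gf minus_eq_smult\<close>)
qed

text \<open>The renaming is an isometry: a Cauchy sequence is pulled back by \<open>g\<close> and
  its limit is pushed forward by \<open>f\<close>.\<close>

lemma banach_space_copy:
  assumes "banach_space X"
  shows "banach_space (copy_space f g X)"
proof -
  interpret C: nvs "copy_space f g X" by (rule nvsI[OF normed_space_copy])
  have "\<exists>x\<in>carrier (copy_space f g X). \<forall>e>0. \<exists>M. \<forall>n\<ge>M.
           nrm (copy_space f g X) (\<sigma> n \<ominus>\<^bsub>copy_space f g X\<^esub> x) < e"
    if \<sigma>: "\<forall>n::nat. \<sigma> n \<in> carrier (copy_space f g X)"
      and Cauchy: "\<forall>e>0. \<exists>M. \<forall>m\<ge>M. \<forall>n\<ge>M. nrm (copy_space f g X) (\<sigma> m \<ominus>\<^bsub>copy_space f g X\<^esub> \<sigma> n) < e" for \<sigma>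
  proof -
    define \<tau> where "\<tau> n = g (\<sigma> n)" for n
    have \<tau>: "\<sigma> n = f (\<tau> n)" "\<tau> n \<in> carrier X" for n
      using \<sigma> by (auto simp: \<tau>_def gf) (metis gf imageE)+
    have nrm_eq: "nrm (copy_space f g X) (\<sigma> n \<ominus>\<^bsub>copy_space f g X\<^esub> f x) = nrm X (\<tau> n \<ominus> x)" if "x \<in> carrier X" for n x
      by (simp add: \<tau>(1) copy_minus[OF \<tau>(2) that] gf)
    have "\<forall>e>0. \<exists>M. \<forall>m\<ge>M. \<forall>n\<ge>M. nrm X (\<tau> m \<ominus> \<tau> n) < e"
      using Cauchy nrm_eq[OF \<tau>(2)] by (simp only: \<tau>(1)[symmetric])
    then obtain x where x: "x \<in> carrier X" "\<forall>e>0. \<exists>M. \<forall>n\<ge>M. nrm X (\<tau> n \<ominus> x) < e"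
      using assms \<tau>(2) unfolding banach_space_def mcomplete_iff by blast
    show ?thesis
      by (rule bexI[of _ "f x"]) (use x nrm_eq[OF x(1)] in simp_all)
  qed
  then show ?thesis
    unfolding banach_space_def C.mcomplete_iff using normed_space_copy by blast
qed

end

end

section \<open>Completeness of the scalar field and of l_1\<close>

lemma banach_space_scalars: "banach_space (scalars :: ('k::{real_normed_field,banach}, 'k) nspace)"
proof -
  interpret S: nvs "scalars :: ('k, 'k) nspace" by (rule nvs_scalars)
  have minus: "x \<ominus>\<^bsub>scalars\<^esub> y = x - y" for x y :: 'k
    by (simp add: a_minus_def S.minus_eq_smult)
  have "\<exists>x. \<forall>e>0. \<exists>M. \<forall>n\<ge>M. norm (\<sigma> n - x) < e"
    if "\<forall>e>0. \<exists>M. \<forall>m\<ge>M. \<forall>n\<ge>M. norm (\<sigma> m - \<sigma> n) < e" for \<sigma> :: "nat \<Rightarrow> 'k"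
  proof -
    have "Cauchy \<sigma>" using that by (simp add: Cauchy_def dist_norm)
    then obtain x where "\<sigma> \<longlonglongrightarrow> x" using convergent_eq_Cauchy by blast
    then show ?thesis by (auto simp: LIMSEQ_def dist_norm)
  qed
  then show ?thesis
    unfolding banach_space_def S.mcomplete_iff minus using normed_space_scalars by simp
qed

lemma l1_seqs_simps [simp]:
  "carrier l1_seqs = {x. summable (\<lambda>n. norm (x n))}" "\<zero>\<^bsub>l1_seqs\<^esub> = (\<lambda>n. 0)"
  "x \<oplus>\<^bsub>l1_seqs\<^esub> y = (\<lambda>n. x n + y n)" "c \<odot>\<^bsub>l1_seqs\<^esub> x = (\<lambda>n. c * x n)"
  "nrm l1_seqs x = (\<Sum>n. norm (x n))"
  by (simp_all add: l1_seqs_def)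

lemma summable_norm_add:
  fixes x y :: "nat \<Rightarrow> 'k::real_normed_vector"
  assumes "summable (\<lambda>n. norm (x n))" "summable (\<lambda>n. norm (y n))"
  shows "summable (\<lambda>n. norm (x n + y n))"
  by (rule summable_comparison_test'[OF summable_add[OF assms], of 0]) (simp add: norm_triangle_ineq)

lemma normed_space_l1_seqs: "normed_space (l1_seqs :: ('k::{real_normed_field,banach}, _) nspace)"
proof -
  have "abelian_group (l1_seqs :: ('k, _) nspace)"
  proof (rule abelian_groupI)
    fix x :: "nat \<Rightarrow> 'k" assume "x \<in> carrier l1_seqs"
    then show "\<exists>y\<in>carrier l1_seqs. y \<oplus>\<^bsub>l1_seqs\<^esub> x = \<zero>\<^bsub>l1_seqs\<^esub>"
      by (intro bexI[of _ "\<lambda>n. - x n"]) auto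
  qed (auto simp: summable_norm_add add_ac)
  then have "Module.module scalars (l1_seqs :: ('k, _) nspace)"
    by (rule moduleI[OF cring_scalars]) (auto simp: algebra_simps norm_mult intro: summable_mult)
  moreover have "(\<Sum>n. norm (x n + y n)) \<le> (\<Sum>n. norm (x n)) + (\<Sum>n. norm (y n))"
    if "summable (\<lambda>n. norm (x n))" "summable (\<lambda>n. norm (y n))" for x y :: "nat \<Rightarrow> 'k"
    unfolding suminf_add[OF that]
    by (rule suminf_le[OF _ summable_norm_add[OF that] summable_add[OF that]]) (rule norm_triangle_ineq)
  moreover have "(\<Sum>n. norm (x n)) = 0 \<longleftrightarrow> x = (\<lambda>n. 0)" if "summable (\<lambda>n. norm (x n))" for x :: "nat \<Rightarrow> 'k"
    using suminf_eq_zero_iff[OF that] by auto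
  ultimately show ?thesis
    by (auto simp: normed_space_def norm_mult suminf_mult intro: suminf_nonneg)
qed

lemma nvs_l1_seqs: "nvs l1_seqs"
  by (rule nvsI[OF normed_space_l1_seqs])

lemma banach_space_l1_seqs: "banach_space (l1_seqs :: ('k::{real_normed_field,banach}, _) nspace)"
proof -
  interpret L: nvs "l1_seqs :: ('k, _) nspace" by (rule nvs_l1_seqs)
  have minus: "x \<ominus>\<^bsub>l1_seqs\<^esub> y = (\<lambda>n. x n - y n)" if "y \<in> carrier l1_seqs" for x y :: "nat \<Rightarrow> 'k"
    unfolding a_minus_def L.minus_eq_smult[OF that] by simp
  have "\<exists>x\<in>carrier l1_seqs. \<forall>e>0. \<exists>M. \<forall>n\<ge>M. nrm l1_seqs (\<sigma> n \<ominus>\<^bsub>l1_seqs\<^esub> x) < e"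
    if \<sigma>: "\<forall>n. \<sigma> n \<in> carrier l1_seqs"
      and "\<forall>e>0. \<exists>M. \<forall>m\<ge>M. \<forall>n\<ge>M. nrm l1_seqs (\<sigma> m \<ominus>\<^bsub>l1_seqs\<^esub> \<sigma> n) < e"
    for \<sigma> :: "nat \<Rightarrow> nat \<Rightarrow> 'k"
  proof -
    have s: "summable (\<lambda>i. norm (\<sigma> n i))" for n using \<sigma> by simp
    have sd: "summable (\<lambda>i. norm (\<sigma> m i - \<sigma> n i))" for m n
      using summable_norm_add[OF s[of m], of "\<lambda>i. - \<sigma> n i"] s[of n] by simp
    have C: "\<exists>M. \<forall>m\<ge>M. \<forall>n\<ge>M. (\<Sum>i. norm (\<sigma> m i - \<sigma> n i)) < e" if "e > 0" for e
      using that \<open>\<forall>e>0. \<exists>M. _ M e\<close> minus \<sigma> by simp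
    have "\<exists>l. (\<lambda>n. \<sigma> n i) \<longlonglongrightarrow> l" for i
    proof -
      have "norm (\<sigma> m i - \<sigma> n i) \<le> (\<Sum>i. norm (\<sigma> m i - \<sigma> n i))" for m n
        using sum_le_suminf[OF sd[of m n], of "{i}"] by simp
      then have "Cauchy (\<lambda>n. \<sigma> n i)"
        unfolding Cauchy_def dist_norm using C by (meson order_le_less_trans)
      then show ?thesis using convergent_eq_Cauchy by blast
    qed
    then obtain x where x: "\<And>i. (\<lambda>n. \<sigma> n i) \<longlonglongrightarrow> x i" by metis
    have lim: "\<exists>M. \<forall>n\<ge>M. summable (\<lambda>i. norm (\<sigma> n i - x i)) \<and> (\<Sum>i. norm (\<sigma> n i - x i)) < e" if e: "e > 0" for e
    proof -
      obtain M where M: "\<And>m n. m \<ge> M \<Longrightarrow> n \<ge> M \<Longrightarrow> (\<Sum>i. norm (\<sigma> m i - \<sigma> n i)) < e / 2"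
        using C[of "e / 2"] e by auto
      have "summable (\<lambda>i. norm (\<sigma> n i - x i)) \<and> (\<Sum>i. norm (\<sigma> n i - x i)) < e" if n: "n \<ge> M" for n
      proof -
        \<comment> \<open>The Cauchy estimate bounds every finite partial sum; letting
          \<open>m\<close> tend to infinity preserves it with a constant independent of
          \<open>K\<close>, so it passes to the whole series.\<close>
        have fin: "(\<Sum>i<K. norm (\<sigma> n i - x i)) \<le> e / 2" for K
        proof (rule LIMSEQ_le_const2)
          show "(\<lambda>m. \<Sum>i<K. norm (\<sigma> n i - \<sigma> m i)) \<longlonglongrightarrow> (\<Sum>i<K. norm (\<sigma> n i - x i))"
            by (intro tendsto_intros x)
          have "(\<Sum>i<K. norm (\<sigma> n i - \<sigma> m i)) \<le> e / 2" if "m \<ge> M" for m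
            using sum_le_suminf[OF sd[of n m], of "{..<K}"] M[OF n that] by simp
          then show "\<exists>M. \<forall>m\<ge>M. (\<Sum>i<K. norm (\<sigma> n i - \<sigma> m i)) \<le> e / 2" by blast
        qed
        have "summable (\<lambda>i. norm (\<sigma> n i - x i))"
          by (rule summableI_nonneg_bounded[OF _ fin]) simp
        moreover from this have "(\<Sum>i. norm (\<sigma> n i - x i)) \<le> e / 2"
          by (rule suminf_le_const) (rule fin)
        ultimately show ?thesis using e by simp
      qed
      then show ?thesis by blast
    qed
    \<comment> \<open>The coordinatewise limit differs from a member of the sequence by an
      absolutely summable sequence, so it is itself in l_1.\<close>
    obtain M where "summable (\<lambda>i. norm (\<sigma> M i - x i))" using lim[of 1] by auto
    then have "summable (\<lambda>i. norm (x i - \<sigma> M i))" by (simp add: norm_minus_commute)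
    then have sx: "summable (\<lambda>i. norm (x i))" using summable_norm_add[OF _ s[of M]] by fastforce
    then have xc: "x \<in> carrier l1_seqs" by simp
    have "\<exists>M. \<forall>n\<ge>M. nrm l1_seqs (\<sigma> n \<ominus>\<^bsub>l1_seqs\<^esub> x) < e" if "e > 0" for e
      using lim[OF that] unfolding minus[OF xc] l1_seqs_simps by blast
    then show ?thesis using xc by blast
  qed
  then show ?thesis
    unfolding banach_space_def L.mcomplete_iff using normed_space_l1_seqs by blast
qed

lemma banach_space_ell1: "banach_space ell1"
  and banach_space_scalar_space: "banach_space scalar_space"
  unfolding ell1_def scalar_space_def
  by (rule nvs.banach_space_copy[OF nvs_l1_seqs _ banach_space_l1_seqs]; simp)
     (rule nvs.banach_space_copy[OF nvs_scalars _ banach_space_scalars]; simp)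

lemma banach_space_nvs: "banach_space X \<Longrightarrow> nvs X"
  by (simp add: banach_space_def nvsI)

lemma scalar_space_simps:
  "carrier scalar_space = range Scalar" "\<zero>\<^bsub>scalar_space\<^esub> = Scalar 0"
  "x \<oplus>\<^bsub>scalar_space\<^esub> y = Scalar (the_scalar x + the_scalar y)"
  "c \<odot>\<^bsub>scalar_space\<^esub> x = Scalar (c * the_scalar x)"
  "nrm scalar_space x = norm (the_scalar x)"
  by (simp_all add: scalar_space_def)

lemma ell1_simps:
  "x \<in> carrier ell1 \<longleftrightarrow> x = Seq (the_seq x) \<and> summable (\<lambda>n. norm (the_seq x n))"
  "\<zero>\<^bsub>ell1\<^esub> = Seq (\<lambda>n. 0)"
  "x \<oplus>\<^bsub>ell1\<^esub> y = Seq (\<lambda>n. the_seq x n + the_seq y n)"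
  "c \<odot>\<^bsub>ell1\<^esub> x = Seq (\<lambda>n. c * the_seq x n)"
  "nrm ell1 x = (\<Sum>n. norm (the_seq x n))"
  by (auto simp: ell1_def image_iff)

lemma nvs_ell1: "nvs ell1" and nvs_scalar_space: "nvs scalar_space"
  by (intro banach_space_nvs banach_space_ell1 banach_space_scalar_space)+

text \<open>The line through \<open>x\<close>. As an inner factor it restricts a multilinear mapping
  to the lines through the entries of a tuple; as the outer factor it turns a form into a multiple
  of a vector.\<close>

definition scalar_mult_op ::
  "('k::{real_normed_field,banach}, 'a) nspace \<Rightarrow> 'a \<Rightarrow> ('k, 'v) point \<Rightarrow> 'a" where
  "scalar_mult_op X x = (\<lambda>c\<in>carrier scalar_space. the_scalar c \<odot>\<^bsub>X\<^esub> x)"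

text \<open>Functionals take values in the bare scalar type, whereas ideals are composed with
  operators between spaces of the universe; hence the wrapping by \<open>Scalar\<close>.\<close>

definition functional_op ::
  "('k::{real_normed_field,banach}, 'a) nspace \<Rightarrow> ('a \<Rightarrow> 'k) \<Rightarrow> 'a \<Rightarrow> ('k, 'v) point" where
  "functional_op Y f = (\<lambda>y\<in>carrier Y. Scalar (f y))"

lemma (in nvs) scalar_mult_op:
  assumes x: "x \<in> carrier X"
  shows "scalar_mult_op X x \<in> carrier (op_space (scalar_space :: ('k, 'v) uspace) X)"
    and "nrm (op_space (scalar_space :: ('k, 'v) uspace) X) (scalar_mult_op X x) \<le> nrm X x"
proof -
  interpret P: nvs_pair "scalar_space :: ('k, 'v) uspace" X
    by (simp add: nvs_pair_def nvs_scalar_space nvs_axioms)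
  show "scalar_mult_op X x \<in> carrier (op_space (scalar_space :: ('k, 'v) uspace) X)"
    by (rule P.op_spaceI[of _ "nrm X x"])
      (use x in \<open>auto simp: scalar_mult_op_def scalar_space_simps smult_add_left smult_smult\<close>)
  show "nrm (op_space (scalar_space :: ('k, 'v) uspace) X) (scalar_mult_op X x) \<le> nrm X x"
    by (rule P.op_nrm_le) (use x in \<open>auto simp: scalar_mult_op_def scalar_space_simps intro!: mult_left_le_one_le\<close>)
qed

lemma (in nvs) functional_op:
  assumes f: "f \<in> carrier (dual X)"
  shows "functional_op X f \<in> carrier (op_space X (scalar_space :: ('k, 'v) uspace))"
    and "nrm (op_space X (scalar_space :: ('k, 'v) uspace)) (functional_op X f) \<le> nrm (dual X) f"
proof -
  interpret P: nvs_pair X "scalar_space :: ('k, 'v) uspace"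
    by (simp add: nvs_pair_def nvs_scalar_space nvs_axioms)
  show "functional_op X f \<in> carrier (op_space X (scalar_space :: ('k, 'v) uspace))"
    by (rule P.op_spaceI[of _ "nrm (dual X) f"])
      (use dualD[OF f] in \<open>auto simp: functional_op_def scalar_space_simps\<close>)
  show "nrm (op_space X (scalar_space :: ('k, 'v) uspace)) (functional_op X f) \<le> nrm (dual X) f"
  proof (rule P.op_nrm_le)
    fix x assume x: "x \<in> carrier X" "nrm X x \<le> 1"
    have "nrm (dual X) f * nrm X x \<le> nrm (dual X) f"
      using dual_nrm_nonneg[OF f] x by (simp add: mult_left_le)
    then show "nrm (scalar_space :: ('k, 'v) uspace) (functional_op X f x) \<le> nrm (dual X) f"
      using dualD(4)[OF f x(1)] x by (simp add: functional_op_def scalar_space_simps)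
  qed
qed

section \<open>Unit vectors and functionals on l_1\<close>

definition unit_vec :: "nat \<Rightarrow> ('k::{real_normed_field,banach}, 'v) point" where
  "unit_vec i = Seq (\<lambda>n. if n = i then 1 else 0)"

text \<open>For finite \<open>P\<close> this has norm at most one. It tests in a single evaluation
  the total mass that an element of the bidual puts on \<open>P\<close>; singletons give the
  coordinate functionals.\<close>

definition coord_sum :: "nat set \<Rightarrow> ('k::{real_normed_field,banach}, 'v) point \<Rightarrow> 'k" where
  "coord_sum P = (\<lambda>x\<in>carrier ell1. \<Sum>i\<in>P. the_seq x i)"

lemma the_seq_unit_vec [simp]: "the_seq (unit_vec i) n = (if n = i then 1 else 0)"
  by (simp add: unit_vec_def)

lemma unit_vec:
  fixes i :: nat
  shows "(unit_vec i :: ('k::{real_normed_field,banach}, 'v) point) \<in> carrier ell1"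
    and "nrm ell1 (unit_vec i :: ('k, 'v) point) = 1"
proof -
  have "(\<lambda>n. norm (the_seq (unit_vec i :: ('k, 'v) point) n)) sums (\<Sum>n\<in>{i}. norm (the_seq (unit_vec i :: ('k, 'v) point) n))"
    by (rule sums_finite) auto
  then have "(\<lambda>n. norm (the_seq (unit_vec i :: ('k, 'v) point) n)) sums 1" by simp
  then show "unit_vec i \<in> (carrier ell1 :: ('k, 'v) point set)" "nrm ell1 (unit_vec i :: ('k, 'v) point) = 1"
    by (auto simp: ell1_simps(1,5) sums_iff) (simp add: unit_vec_def)
qed

lemma coord_sum_bound:
  assumes "x \<in> carrier ell1" "finite P"
  shows "(\<Sum>i\<in>P. norm (the_seq x i)) \<le> nrm ell1 x"
  using assms by (simp add: ell1_simps sum_le_suminf)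

lemma coord_sum:
  assumes P: "finite P"
  shows "(coord_sum P :: ('k::{real_normed_field,banach}, 'v) point \<Rightarrow> 'k) \<in> carrier (dual ell1)"
    and "nrm (dual ell1) (coord_sum P :: ('k, 'v) point \<Rightarrow> 'k) \<le> 1"
proof -
  interpret E: nvs "ell1 :: ('k, 'v) uspace" by (rule nvs_ell1)
  have le: "norm (coord_sum P x) \<le> nrm ell1 x" if "x \<in> carrier ell1" for x :: "('k, 'v) point"
    using coord_sum_bound[OF that P] norm_sum[of "the_seq x" P] that by (simp add: coord_sum_def)
  show "(coord_sum P :: ('k, 'v) point \<Rightarrow> 'k) \<in> carrier (dual ell1)"
  proof (rule E.dualI[of _ 1])
    fix x y :: "('k, 'v) point" assume "x \<in> carrier ell1" "y \<in> carrier ell1"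
    then show "coord_sum P (x \<oplus>\<^bsub>ell1\<^esub> y) = coord_sum P x + coord_sum P y"
      using E.add_in[of x y] by (simp add: coord_sum_def) (simp add: ell1_simps sum.distrib)
  next
    fix c and x :: "('k, 'v) point" assume "x \<in> carrier ell1"
    then show "coord_sum P (c \<odot>\<^bsub>ell1\<^esub> x) = c * coord_sum P x"
      using E.smult_in[of x c] by (simp add: coord_sum_def) (simp add: ell1_simps sum_distrib_left)
  qed (use le in \<open>auto simp: coord_sum_def\<close>)
  show "nrm (dual ell1) (coord_sum P :: ('k, 'v) point \<Rightarrow> 'k) \<le> 1"
    by (rule E.dual_nrm_le') (use le in auto)
qed

text \<open>A bounded functional on l_1 is controlled by its values at the unit vectors: on
  truncations \<open>M\<close> suffices, while \<open>C\<close> enters only through the tails, whose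
  norms tend to zero. Linearity is assumed directly because the lemma is applied to slices of forms,
  which need not be extensional.\<close>

lemma ell1_functional_bound:
  fixes \<phi> :: "('k::{real_normed_field,banach}, 'v) point \<Rightarrow> 'k"
  assumes add: "\<And>x y. x \<in> carrier ell1 \<Longrightarrow> y \<in> carrier ell1 \<Longrightarrow> \<phi> (x \<oplus>\<^bsub>ell1\<^esub> y) = \<phi> x + \<phi> y"
    and smult: "\<And>c x. x \<in> carrier ell1 \<Longrightarrow> \<phi> (c \<odot>\<^bsub>ell1\<^esub> x) = c * \<phi> x"
    and bound: "\<And>x. x \<in> carrier ell1 \<Longrightarrow> norm (\<phi> x) \<le> C * nrm ell1 x"
    and M: "\<And>i. norm (\<phi> (unit_vec i)) \<le> M"
    and x: "x \<in> carrier ell1"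
  shows "norm (\<phi> x) \<le> M * nrm ell1 x"
proof -
  interpret E: nvs "ell1 :: ('k, 'v) uspace" by (rule nvs_ell1)
  have M0: "M \<ge> 0" using M[of 0] norm_ge_zero order_trans by blast
  let ?x = "the_seq x"
  have sx: "summable (\<lambda>n. norm (?x n))" and xS: "x = Seq ?x" using x ell1_simps(1) by blast+
  \<comment> \<open>The truncation \<open>u n\<close> is a finite combination of unit vectors, and
    \<open>v n\<close> is the tail.\<close>
  define u where "u n = (Seq (\<lambda>i. if i < n then ?x i else 0) :: ('k, 'v) point)" for n
  define v where "v n = (Seq (\<lambda>i. if i < n then 0 else ?x i) :: ('k, 'v) point)" for n
  have u: "u n \<in> carrier ell1" and v: "v n \<in> carrier ell1" for n
    unfolding u_def v_def ell1_simps(1) point.sel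
    by (auto intro!: summable_comparison_test'[OF sx, of 0])
  have uv: "x = u n \<oplus>\<^bsub>ell1\<^esub> v n" for n
    unfolding ell1_simps(3) u_def v_def by (subst xS) auto
  have \<phi>u: "\<phi> (u n) = (\<Sum>i<n. ?x i * \<phi> (unit_vec i))" for n
  proof (induction n)
    case 0
    have "u 0 = 0 \<odot>\<^bsub>ell1\<^esub> x" by (simp add: u_def ell1_simps)
    then show ?case using smult[OF x, of 0] by simp
  next
    case (Suc n)
    have "u (Suc n) = u n \<oplus>\<^bsub>ell1\<^esub> (?x n \<odot>\<^bsub>ell1\<^esub> unit_vec n)"
      by (auto simp: u_def ell1_simps unit_vec_def less_Suc_eq)
    then show ?case using add[OF u[of n] E.smult_in[OF unit_vec(1)]] smult[OF unit_vec(1)] Suc by simp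
  qed
  have nv: "nrm ell1 (v n) = nrm ell1 x - (\<Sum>i<n. norm (?x i))" for n
  proof -
    have "nrm ell1 (v n) = (\<Sum>i. norm (the_seq (v n) (i + n))) + (\<Sum>i<n. norm (the_seq (v n) i))"
      using v[of n] suminf_split_initial_segment[of "\<lambda>i. norm (the_seq (v n) i)" n] by (simp add: ell1_simps)
    also have "\<dots> = (\<Sum>i. norm (?x (i + n)))" by (simp add: v_def)
    finally show ?thesis using suminf_split_initial_segment[OF sx, of n] by (simp add: ell1_simps)
  qed
  have "norm (\<phi> x) \<le> M * nrm ell1 x + C * (nrm ell1 x - (\<Sum>i<n. norm (?x i)))" for n
  proof -
    have "norm (\<phi> (u n)) \<le> (\<Sum>i<n. norm (?x i) * M)"
      unfolding \<phi>u by (rule sum_norm_le) (simp add: norm_mult mult_left_mono M)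
    also have "\<dots> = M * (\<Sum>i<n. norm (?x i))" by (simp add: sum_distrib_left mult.commute)
    also have "\<dots> \<le> M * nrm ell1 x" using coord_sum_bound[OF x, of "{..<n}"] M0 by (simp add: mult_left_mono)
    finally have "norm (\<phi> (u n)) \<le> M * nrm ell1 x" .
    moreover have "norm (\<phi> x) \<le> norm (\<phi> (u n)) + norm (\<phi> (v n))"
      using add[OF u[of n] v[of n]] uv[of n] norm_triangle_ineq by metis
    ultimately show ?thesis using bound[OF v[of n]] nv[of n] by simp
  qed
  moreover have "(\<lambda>n. M * nrm ell1 x + C * (nrm ell1 x - (\<Sum>i<n. norm (?x i)))) \<longlonglongrightarrow>
      M * nrm ell1 x + C * (nrm ell1 x - nrm ell1 x)"
    unfolding ell1_simps(5) by (intro tendsto_intros summable_LIMSEQ sx)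
  ultimately have "norm (\<phi> x) \<le> M * nrm ell1 x + C * (nrm ell1 x - nrm ell1 x)"
    by (intro LIMSEQ_le_const) auto
  then show ?thesis by simp
qed

section \<open>Iterated limits of bounded multilinear forms\<close>

text \<open>Continuity is expressed by an explicit constant, so that the constant can be followed
  through limits and sharpened. For \<open>N = 0\<close> the product is empty and \<open>B\<close>
  bounds the value itself; this is how bounds on full iterated limits are read off.\<close>

definition bounded_form ::
  "nat \<Rightarrow> (nat \<Rightarrow> ('k::{real_normed_field,banach}, 'a) nspace) \<Rightarrow> real \<Rightarrow> ((nat \<Rightarrow> 'a) \<Rightarrow> 'k) \<Rightarrow> bool" where
  "bounded_form N X B G \<longleftrightarrow>
     (\<forall>j<N. \<forall>x\<in>tuples N X. \<forall>s\<in>carrier (X j). \<forall>t\<in>carrier (X j).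
        G (x(j := s \<oplus>\<^bsub>X j\<^esub> t)) = G (x(j := s)) + G (x(j := t))) \<and>
     (\<forall>j<N. \<forall>x\<in>tuples N X. \<forall>c. \<forall>s\<in>carrier (X j).
        G (x(j := c \<odot>\<^bsub>X j\<^esub> s)) = c * G (x(j := s))) \<and>
     0 \<le> B \<and> (\<forall>x\<in>tuples N X. norm (G x) \<le> B * (\<Prod>j<N. nrm (X j) (x j)))"

lemma bounded_formD:
  assumes "bounded_form N X B G"
  shows "\<And>j x s t. j < N \<Longrightarrow> x \<in> tuples N X \<Longrightarrow> s \<in> carrier (X j) \<Longrightarrow> t \<in> carrier (X j) \<Longrightarrow>
           G (x(j := s \<oplus>\<^bsub>X j\<^esub> t)) = G (x(j := s)) + G (x(j := t))"
    and "\<And>j x c s. j < N \<Longrightarrow> x \<in> tuples N X \<Longrightarrow> s \<in> carrier (X j) \<Longrightarrow>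
           G (x(j := c \<odot>\<^bsub>X j\<^esub> s)) = c * G (x(j := s))"
    and "0 \<le> B"
    and "\<And>x. x \<in> tuples N X \<Longrightarrow> norm (G x) \<le> B * (\<Prod>j<N. nrm (X j) (x j))"
  using assms unfolding bounded_form_def by blast+

lemma tuple_snoc: "x \<in> tuples n X \<Longrightarrow> t \<in> carrier (X n) \<Longrightarrow> x(n := t) \<in> tuples (Suc n) X"
  unfolding lessThan_Suc by (rule PiE_fun_upd)

text \<open>One step of the Arens extension: the functional in the last coordinate, with the earlier
  ones fixed, is evaluated by the bidual element \<open>a\<close>.\<close>

definition contract ::
  "(nat \<Rightarrow> ('k::{real_normed_field,banach}, 'a) nspace) \<Rightarrow> (('a \<Rightarrow> 'k) \<Rightarrow> 'k) \<Rightarrow> nat \<Rightarrow>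
   ((nat \<Rightarrow> 'a) \<Rightarrow> 'k) \<Rightarrow> (nat \<Rightarrow> 'a) \<Rightarrow> 'k" where
  "contract X a n G x = a (\<lambda>t\<in>carrier (X n). G (x(n := t)))"

lemma slice:
  assumes G: "bounded_form (Suc n) X B G" and X: "nvs (X n)" and x: "x \<in> tuples n X"
    and pos: "0 \<le> (\<Prod>j<n. nrm (X j) (x j))"
  shows "(\<lambda>t\<in>carrier (X n). G (x(n := t))) \<in> carrier (dual (X n))"
    and "nrm (dual (X n)) (\<lambda>t\<in>carrier (X n). G (x(n := t))) \<le> B * (\<Prod>j<n. nrm (X j) (x j))"
proof -
  interpret Xn: nvs "X n" by (rule X)
  have x0: "x(n := \<zero>\<^bsub>X n\<^esub>) \<in> tuples (Suc n) X" by (rule tuple_snoc[OF x Xn.zero_in])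
  have le: "norm (G (x(n := t))) \<le> B * (\<Prod>j<n. nrm (X j) (x j)) * nrm (X n) t" if "t \<in> carrier (X n)" for t
    using bounded_formD(4)[OF G tuple_snoc[OF x that]] by (simp add: mult.assoc)
  show "(\<lambda>t\<in>carrier (X n). G (x(n := t))) \<in> carrier (dual (X n))"
    by (rule Xn.dualI[of _ "B * (\<Prod>j<n. nrm (X j) (x j))"])
      (use le bounded_formD(1,2)[OF G _ x0, of n] in auto)
  show "nrm (dual (X n)) (\<lambda>t\<in>carrier (X n). G (x(n := t))) \<le> B * (\<Prod>j<n. nrm (X j) (x j))"
    by (rule Xn.dual_nrm_le') (use le bounded_formD(3)[OF G] pos in auto)
qed

section \<open>Successive evaluation at a tuple in the unit balls of the biduals\<close>

locale bidual_tuple =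
  fixes N :: nat and X :: "nat \<Rightarrow> ('k::{real_normed_field,banach}, 'a) nspace"
    and a :: "nat \<Rightarrow> ('a \<Rightarrow> 'k) \<Rightarrow> 'k"
  assumes nvs_X: "\<And>j. j < N \<Longrightarrow> nvs (X j)"
    and a: "\<And>j. j < N \<Longrightarrow> a j \<in> carrier (bidual (X j))"
    and nrm_a: "\<And>j. j < N \<Longrightarrow> nrm (bidual (X j)) (a j) \<le> 1"
begin

lemma prod_nrm_nonneg:
  assumes "n \<le> N" "x \<in> tuples n X"
  shows "0 \<le> (\<Prod>j<n. nrm (X j) (x j))"
proof (rule prod_nonneg)
  fix j assume "j \<in> {..<n}"
  then show "0 \<le> nrm (X j) (x j)"
    using nvs.nrm_nonneg[OF nvs_X] PiE_mem[OF assms(2)] assms(1) by simp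
qed

text \<open>The operations of the dual are written out as restricted functions, the shape in which
  slices of forms occur.\<close>

lemma a_apply:
  assumes "j < N"
  shows "\<And>f g. f \<in> carrier (dual (X j)) \<Longrightarrow> g \<in> carrier (dual (X j)) \<Longrightarrow>
           a j (\<lambda>x\<in>carrier (X j). f x + g x) = a j f + a j g"
    and "\<And>f c. f \<in> carrier (dual (X j)) \<Longrightarrow> a j (\<lambda>x\<in>carrier (X j). c * f x) = c * a j f"
    and "\<And>f. f \<in> carrier (dual (X j)) \<Longrightarrow> norm (a j f) \<le> nrm (dual (X j)) f"
proof -
  interpret Xj: nvs "X j" by (rule nvs_X[OF assms])
  interpret D: nvs "dual (X j)" by (rule nvs_dual) (rule nvs_X[OF assms])
  note aj = D.dualD[OF a[OF assms], unfolded Xj.dual_simps]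
  show "\<And>f g. f \<in> carrier (dual (X j)) \<Longrightarrow> g \<in> carrier (dual (X j)) \<Longrightarrow>
           a j (\<lambda>x\<in>carrier (X j). f x + g x) = a j f + a j g"
    "\<And>f c. f \<in> carrier (dual (X j)) \<Longrightarrow> a j (\<lambda>x\<in>carrier (X j). c * f x) = c * a j f"
    using aj by blast+
  fix f assume f: "f \<in> carrier (dual (X j))"
  have "nrm (bidual (X j)) (a j) * nrm (dual (X j)) f \<le> 1 * nrm (dual (X j)) f"
    by (rule mult_right_mono[OF nrm_a[OF assms] D.nrm_nonneg[OF f]])
  then show "norm (a j f) \<le> nrm (dual (X j)) f" using aj(4)[OF f] by simp
qed

text \<open>Since \<open>a n\<close> has norm at most one, the contraction keeps the constant
  \<open>B\<close>.\<close>

lemma bounded_form_contract: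
  assumes G: "bounded_form (Suc n) X B G" and n: "n < N"
  shows "bounded_form n X B (contract X (a n) n G)"
proof -
  have pos: "0 \<le> (\<Prod>j<n. nrm (X j) (x j))" if "x \<in> tuples n X" for x
    using prod_nrm_nonneg[OF _ that] n by simp
  have sl: "(\<lambda>t\<in>carrier (X n). G (x(n := t))) \<in> carrier (dual (X n))"
    "nrm (dual (X n)) (\<lambda>t\<in>carrier (X n). G (x(n := t))) \<le> B * (\<Prod>j<n. nrm (X j) (x j))"
    if "x \<in> tuples n X" for x
    using slice[OF G nvs_X[OF n] that pos[OF that]] by blast+
  show ?thesis
    unfolding bounded_form_def
  proof (intro conjI allI impI ballI)
    fix j x s t assume j: "j < n" and x: "x \<in> tuples n X"
      and s: "s \<in> carrier (X j)" and t: "t \<in> carrier (X j)"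
    have "G ((x(j := s \<oplus>\<^bsub>X j\<^esub> t))(n := u)) = G ((x(j := s))(n := u)) + G ((x(j := t))(n := u))"
      if "u \<in> carrier (X n)" for u
      using bounded_formD(1)[OF G _ tuple_snoc[OF x that] s t] j by (simp add: fun_upd_twist)
    \<comment> \<open>The nested restrictions exhibit the slice as a sum of two members of the dual,
      as \<open>a_apply\<close> requires.\<close>
    then have "(\<lambda>u\<in>carrier (X n). G ((x(j := s \<oplus>\<^bsub>X j\<^esub> t))(n := u))) =
        (\<lambda>u\<in>carrier (X n). (\<lambda>u\<in>carrier (X n). G ((x(j := s))(n := u))) u + (\<lambda>u\<in>carrier (X n). G ((x(j := t))(n := u))) u)"
      by (intro restrict_ext) simp
    then show "contract X (a n) n G (x(j := s \<oplus>\<^bsub>X j\<^esub> t)) =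
        contract X (a n) n G (x(j := s)) + contract X (a n) n G (x(j := t))"
      unfolding contract_def
      by (simp only: a_apply(1)[OF n sl(1)[OF tuple_upd[where X = X, OF x j s]] sl(1)[OF tuple_upd[where X = X, OF x j t]]])
  next
    fix j x c s assume j: "j < n" and x: "x \<in> tuples n X" and s: "s \<in> carrier (X j)"
    have "G ((x(j := c \<odot>\<^bsub>X j\<^esub> s))(n := u)) = c * G ((x(j := s))(n := u))"
      if "u \<in> carrier (X n)" for u
      using bounded_formD(2)[OF G _ tuple_snoc[OF x that] s] j by (simp add: fun_upd_twist)
    then have "(\<lambda>u\<in>carrier (X n). G ((x(j := c \<odot>\<^bsub>X j\<^esub> s))(n := u))) =
        (\<lambda>u\<in>carrier (X n). c * (\<lambda>u\<in>carrier (X n). G ((x(j := s))(n := u))) u)"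
      by (intro restrict_ext) simp
    then show "contract X (a n) n G (x(j := c \<odot>\<^bsub>X j\<^esub> s)) = c * contract X (a n) n G (x(j := s))"
      unfolding contract_def
      by (simp only: a_apply(2)[OF n sl(1)[OF tuple_upd[where X = X, OF x j s]]])
  next
    show "0 \<le> B" by (rule bounded_formD(3)[OF G])
    fix x assume x: "x \<in> tuples n X"
    show "norm (contract X (a n) n G x) \<le> B * (\<Prod>j<n. nrm (X j) (x j))"
      unfolding contract_def using a_apply(3)[OF n sl(1)[OF x]] sl(2)[OF x] by simp
  qed
qed

text \<open>The innermost limit of the Arens extension belongs to the last coordinate, so the
  coordinates are contracted from \<open>N - 1\<close> downwards. After \<open>d\<close> steps the
  first \<open>N - d\<close> remain free; after \<open>N\<close> steps the result is the value of
  the extension at \<open>a\<close>.\<close>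

primrec partial_limit :: "((nat \<Rightarrow> 'a) \<Rightarrow> 'k) \<Rightarrow> nat \<Rightarrow> (nat \<Rightarrow> 'a) \<Rightarrow> 'k" where
  "partial_limit G 0 = G"
| "partial_limit G (Suc d) = contract X (a (N - Suc d)) (N - Suc d) (partial_limit G d)"

lemma bounded_form_partial_limit:
  "bounded_form N X B G \<Longrightarrow> d \<le> N \<Longrightarrow> bounded_form (N - d) X B (partial_limit G d)"
proof (induction d)
  case (Suc d)
  have e: "Suc (N - Suc d) = N - d" and n: "N - Suc d < N" using Suc.prems by simp_all
  have "bounded_form (N - d) X B (partial_limit G d)" using Suc by simp
  from bounded_form_contract[OF this[folded e] n] show ?case by simp
qed simp

lemma partial_limit_slice:
  assumes "bounded_form N X B G" "Suc d \<le> N" "x \<in> tuples (N - Suc d) X"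
  shows "(\<lambda>t\<in>carrier (X (N - Suc d)). partial_limit G d (x(N - Suc d := t))) \<in> carrier (dual (X (N - Suc d)))"
proof (rule slice(1))
  show "bounded_form (Suc (N - Suc d)) X B (partial_limit G d)"
    using bounded_form_partial_limit[OF assms(1), of d] assms(2) by (simp add: Suc_diff_Suc)
  show "nvs (X (N - Suc d))" by (rule nvs_X) (use assms(2) in simp)
  show "x \<in> tuples (N - Suc d) X" by (rule assms(3))
  then show "0 \<le> (\<Prod>j<N - Suc d. nrm (X j) (x j))" by (rule prod_nrm_nonneg[rotated]) simp
qed

text \<open>Each \<open>a j\<close> is linear on the dual, so linearity in the form survives every
  contraction. This gives the effect of a perturbation on the extension.\<close>

lemma partial_limit_linear:
  assumes G1: "bounded_form N X B1 G1" and G2: "bounded_form N X B2 G2"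
    and G: "\<And>x. x \<in> tuples N X \<Longrightarrow> G x = G1 x + c * G2 x"
    and "d \<le> N" "x \<in> tuples (N - d) X"
  shows "partial_limit G d x = partial_limit G1 d x + c * partial_limit G2 d x"
  using assms(4,5)
proof (induction d arbitrary: x)
  case (Suc d)
  let ?n = "N - Suc d"
  have n: "?n < N" and nd: "Suc ?n = N - d" using Suc.prems by auto
  note s1 = partial_limit_slice[OF G1 Suc.prems] and s2 = partial_limit_slice[OF G2 Suc.prems]
  interpret Xn: nvs "X ?n" by (rule nvs_X[OF n])
  interpret D: nvs "dual (X ?n)" by (rule nvs_dual) (rule nvs_X[OF n])
  have "partial_limit G d (x(?n := t)) = partial_limit G1 d (x(?n := t)) + c * partial_limit G2 d (x(?n := t))"
    if "t \<in> carrier (X ?n)" for t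
    by (rule Suc.IH[OF _ tuple_snoc[OF Suc.prems(2) that, unfolded nd]]) (use Suc.prems(1) in simp)
  then have "(\<lambda>t\<in>carrier (X ?n). partial_limit G d (x(?n := t))) =
      (\<lambda>u\<in>carrier (X ?n). (\<lambda>t\<in>carrier (X ?n). partial_limit G1 d (x(?n := t))) u +
         (\<lambda>u\<in>carrier (X ?n). c * (\<lambda>t\<in>carrier (X ?n). partial_limit G2 d (x(?n := t))) u) u)"
    by (intro restrict_ext) simp
  then show ?case
    using a_apply(1)[OF n s1 D.smult_in[OF s2, of c, unfolded Xn.dual_simps]] a_apply(2)[OF n s2, of c]
    by (simp add: contract_def)
qed (simp add: G)

text \<open>With the other coordinates fixed, an elementary form is a multiple of one functional;
  each contraction therefore replaces a factor \<open>p j (x j)\<close> by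
  \<open>a j (p j)\<close>.\<close>

lemma partial_limit_prod:
  assumes p: "\<And>j. j < N \<Longrightarrow> p j \<in> carrier (dual (X j))"
    and "d \<le> N" "x \<in> tuples (N - d) X"
  shows "partial_limit (\<lambda>x. \<Prod>j<N. p j (x j)) d x = (\<Prod>j\<in>{N - d..<N}. a j (p j)) * (\<Prod>j<N - d. p j (x j))"
  using assms(2,3)
proof (induction d arbitrary: x)
  case (Suc d)
  let ?n = "N - Suc d"
  have n: "?n < N" and nd: "N - d = Suc ?n" using Suc.prems by auto
  let ?c = "(\<Prod>j\<in>{N - d..<N}. a j (p j)) * (\<Prod>j<?n. p j (x j))"
  have "partial_limit (\<lambda>x. \<Prod>j<N. p j (x j)) d (x(?n := t)) = ?c * p ?n t" if "t \<in> carrier (X ?n)" for t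
  proof -
    have "partial_limit (\<lambda>x. \<Prod>j<N. p j (x j)) d (x(?n := t)) =
        (\<Prod>j\<in>{N - d..<N}. a j (p j)) * (\<Prod>j<N - d. p j ((x(?n := t)) j))"
      by (rule Suc.IH[OF _ tuple_snoc[OF Suc.prems(2) that, folded nd]]) (use Suc.prems(1) in simp)
    then show ?thesis by (simp add: nd)
  qed
  then have "(\<lambda>t\<in>carrier (X ?n). partial_limit (\<lambda>x. \<Prod>j<N. p j (x j)) d (x(?n := t))) =
      (\<lambda>t\<in>carrier (X ?n). ?c * p ?n t)"
    by (intro restrict_ext) simp
  then have "partial_limit (\<lambda>x. \<Prod>j<N. p j (x j)) (Suc d) x = ?c * a ?n (p ?n)"
    using a_apply(2)[OF n p[OF n], of ?c] by (simp add: contract_def)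
  moreover have "{?n..<N} = insert ?n {N - d..<N}" using n nd by auto
  ultimately show ?case using nd by simp
qed simp

text \<open>Tested with \<open>f\<close>, the values along a net in coordinate \<open>k\<close> are
  those of a functional on \<open>X k\<close>, and weak-star convergence of the net to
  \<open>a k\<close> forces the limit to be \<open>a k\<close> at this functional. Thus the iterated
  limit depends on \<open>a\<close> alone and not on the nets.\<close>

lemma iterated_wlim_eq_partial_limit:
  assumes "iterated_wlim N X Y F \<Psi> k x z"
    and f: "f \<in> carrier (dual Y)"
    and G: "bounded_form N X B (\<lambda>x. f (\<Psi> x))"
    and F: "\<And>j. j < N \<Longrightarrow> bounded_wstar_net (X j) (a j) (F j)"
    and "k \<le> N" "x \<in> tuples k X"
  shows "z f = partial_limit (\<lambda>x. f (\<Psi> x)) (N - k) x"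
  using assms(1,5,6)
proof induction
  case (base x)
  then show ?case using f by (simp add: canon_def)
next
  case (step k h x z)
  let ?L = "partial_limit (\<lambda>x. f (\<Psi> x)) (N - Suc k)"
  define \<phi> where "\<phi> = (\<lambda>t\<in>carrier (X k). ?L (x(k := t)))"
  have k: "k < N" "N - Suc (N - Suc k) = k" "N - k = Suc (N - Suc k)" using step by auto
  have \<phi>: "\<phi> \<in> carrier (dual (X k))"
    using partial_limit_slice[OF G, of "N - Suc k" x] k step.prems by (simp add: \<phi>_def)
  note net = F[OF k(1), unfolded bounded_wstar_net_def]
  have "h t f = canon (X k) t \<phi>" if "t \<in> carrier (X k)" for t
  proof -
    have "h t f = ?L (x(k := t))"
      using bspec[OF step.IH that] tuple_snoc[OF step.prems(2) that] k(1) Suc_leI by blast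
    then show ?thesis using that \<phi> by (simp add: canon_def) (simp add: \<phi>_def)
  qed
  \<comment> \<open>The identification with \<phi> holds on the carrier, where the net eventually
    lies.\<close>
  moreover have "eventually (\<lambda>t. t \<in> carrier (X k)) (F k)"
    using net eventually_mono by fastforce
  ultimately have "eventually (\<lambda>t. canon (X k) t \<phi> = h t f) (F k)"
    by (auto elim: eventually_mono)
  moreover have "((\<lambda>t. canon (X k) t \<phi>) \<longlongrightarrow> a k \<phi>) (F k)"
    using net \<phi> by (simp add: wstar_tendsto_def)
  ultimately have "((\<lambda>t. h t f) \<longlongrightarrow> a k \<phi>) (F k)"
    by (simp add: tendsto_cong)
  moreover have "((\<lambda>t. h t f) \<longlongrightarrow> z f) (F k)"
    using step.hyps f by (simp add: wstar_tendsto_def)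
  ultimately have "z f = a k \<phi>"
    using net tendsto_unique by blast
  then show ?case by (simp add: k contract_def \<phi>_def)
qed

end

text \<open>Testing with a functional passes to scalar forms. The constant is left open, as on l_1
  it will be sharpened through the values at basis tuples.\<close>

lemma (in nvs_tuple) bounded_form_comp:
  assumes \<Psi>: "\<Psi> \<in> carrier (multilin_space N X Y)" and f: "f \<in> carrier (dual Y)" and N: "N > 0"
  obtains B where "bounded_form N X B (\<lambda>x. f (\<Psi> x))"
proof -
  obtain C where C: "C > 0" "\<And>x. x \<in> tuples N X \<Longrightarrow> nrm Y (\<Psi> x) \<le> C * (\<Prod>j<N. nrm (X j) (x j))"
    using multilin_bounded[OF \<Psi> N] by blast
  note D = multilin_spaceD[OF \<Psi>]
  have "norm (f (\<Psi> x)) \<le> nrm (dual Y) f * C * (\<Prod>j<N. nrm (X j) (x j))" if x: "x \<in> tuples N X" for x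
    using Y.dualD(4)[OF f D(2)[OF x]] mult_left_mono[OF C(2)[OF x] Y.dual_nrm_nonneg[OF f]] by (simp add: mult.assoc)
  moreover have "0 \<le> nrm (dual Y) f * C" using Y.dual_nrm_nonneg[OF f] C(1) by simp
  moreover have "\<Psi> (x(j := s)) \<in> carrier Y" if "j < N" "x \<in> tuples N X" "s \<in> carrier (X j)" for j x s
    using D(2)[OF tuple_upd[where X = X, OF that(2,1,3)]] .
  ultimately have "bounded_form N X (nrm (dual Y) f * C) (\<lambda>x. f (\<Psi> x))"
    unfolding bounded_form_def using D(3,4) Y.dualD(2,3)[OF f] by simp
  then show ?thesis by (rule that)
qed

lemma bounded_form_prod:
  assumes X: "\<And>j. j < N \<Longrightarrow> nvs (X j)" and p: "\<And>j. j < N \<Longrightarrow> p j \<in> carrier (dual (X j))"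
    and nrm_p: "\<And>j. j < N \<Longrightarrow> nrm (dual (X j)) (p j) \<le> 1"
  shows "bounded_form N X 1 (\<lambda>x. \<Prod>j<N. p j (x j))"
proof -
  \<comment> \<open>Updating coordinate \<open>i\<close> affects only the factor with index
    \<open>i\<close>, so linearity reduces to that of \<open>p i\<close>.\<close>
  have upd: "(\<Prod>j<N. p j ((x(i := s)) j)) = p i s * (\<Prod>j\<in>{..<N} - {i}. p j (x j))" if "i < N" for i x s
    using that by (subst prod.remove[of _ i]) (auto intro!: prod.cong)
  note D = nvs.dualD[OF X p]
  have "norm (p j t) \<le> nrm (X j) t" if "j < N" "t \<in> carrier (X j)" for j t
  proof -
    have "nrm (dual (X j)) (p j) * nrm (X j) t \<le> 1 * nrm (X j) t"
      by (rule mult_right_mono) (use nrm_p nvs.nrm_nonneg[OF X] that in auto)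
    then show ?thesis using D(4)[OF that(1) that(1) that(2)] by simp
  qed
  then have "(\<Prod>j<N. norm (p j (x j))) \<le> (\<Prod>j<N. nrm (X j) (x j))" if "x \<in> tuples N X" for x
    by (intro prod_mono) (use that in auto)
  then have "norm (\<Prod>j<N. p j (x j)) \<le> 1 * (\<Prod>j<N. nrm (X j) (x j))" if "x \<in> tuples N X" for x
    using that by (simp add: prod_norm)
  moreover have "(\<Prod>j<N. p j ((x(i := s \<oplus>\<^bsub>X i\<^esub> t)) j)) = (\<Prod>j<N. p j ((x(i := s)) j)) + (\<Prod>j<N. p j ((x(i := t)) j))"
    if "i < N" "s \<in> carrier (X i)" "t \<in> carrier (X i)" for i x s t
    by (simp only: upd[OF that(1)] D(2)[OF that(1) that(1) that(2,3)] distrib_right)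
  moreover have "(\<Prod>j<N. p j ((x(i := c \<odot>\<^bsub>X i\<^esub> s)) j)) = c * (\<Prod>j<N. p j ((x(i := s)) j))"
    if "i < N" "s \<in> carrier (X i)" for i x c s
    by (simp only: upd[OF that(1)] D(3)[OF that(1) that(1) that(2)] mult.assoc)
  ultimately show ?thesis
    unfolding bounded_form_def by (intro conjI ballI allI impI) simp_all
qed

lemma bounded_form_lincomb:
  assumes G: "bounded_form N X B G" and H: "bounded_form N X C H"
  shows "bounded_form N X (B + norm c * C) (\<lambda>x. G x + c * H x)"
proof -
  have "norm (G x + c * H x) \<le> (B + norm c * C) * (\<Prod>j<N. nrm (X j) (x j))" if x: "x \<in> tuples N X" for x
  proof -
    have "norm (G x + c * H x) \<le> norm (G x) + norm c * norm (H x)"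
      by (metis norm_mult norm_triangle_ineq)
    also have "\<dots> \<le> B * (\<Prod>j<N. nrm (X j) (x j)) + norm c * (C * (\<Prod>j<N. nrm (X j) (x j)))"
      by (intro add_mono mult_left_mono bounded_formD(4)[OF G x] bounded_formD(4)[OF H x]) auto
    finally show ?thesis by (simp add: algebra_simps)
  qed
  then show ?thesis
    using bounded_formD(1-3)[OF G] bounded_formD(1-3)[OF H]
    unfolding bounded_form_def by (simp add: algebra_simps)
qed

section \<open>Multilinear forms on \<open>l\<^sub>1\<close>\<close>

abbreviation basis_tuple :: "nat \<Rightarrow> (nat \<Rightarrow> nat) \<Rightarrow> nat \<Rightarrow> ('k::{real_normed_field,banach}, 'v) point" where
  "basis_tuple N \<iota> \<equiv> (\<lambda>j\<in>{..<N}. unit_vec (\<iota> j))"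

lemma basis_tuple_in: "basis_tuple N \<iota> \<in> tuples N (\<lambda>_. ell1)"
  by (auto intro: unit_vec)

text \<open>The norm of a form on a product of l_1 spaces is determined by its values at tuples of
  unit vectors. Coordinates are freed one at a time, each by the linear estimate
  \<open>ell1_functional_bound\<close>.\<close>

lemma bounded_form_ell1:
  fixes G :: "(nat \<Rightarrow> ('k::{real_normed_field,banach}, 'v) point) \<Rightarrow> 'k"
  assumes G: "bounded_form N (\<lambda>_. ell1) B G" and M: "\<And>\<iota>. norm (G (basis_tuple N \<iota>)) \<le> M"
  shows "bounded_form N (\<lambda>_. ell1) M G"
proof -
  let ?X = "\<lambda>_::nat. ell1 :: ('k, 'v) uspace"
  interpret E: nvs "ell1 :: ('k, 'v) uspace" by (rule nvs_ell1)
  have M0: "M \<ge> 0" using M[of undefined] norm_ge_zero order_trans by blast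
  \<comment> \<open>Here the first \<open>n\<close> coordinates are arbitrary and the remaining ones
    are unit vectors.\<close>
  have "norm (G x) \<le> M * (\<Prod>j<n. nrm ell1 (x j))"
    if "n \<le> N" "x \<in> tuples N ?X" "\<And>j. n \<le> j \<Longrightarrow> j < N \<Longrightarrow> x j \<in> range unit_vec" for n x
    using that
  proof (induction n arbitrary: x)
    case 0
    then have "\<forall>j. \<exists>i. j < N \<longrightarrow> x j = unit_vec i" by blast
    then obtain \<iota> where "\<And>j. j < N \<Longrightarrow> x j = unit_vec (\<iota> j)" by metis
    then have "x = basis_tuple N \<iota>" using 0 by (auto simp: fun_eq_iff PiE_def extensional_def)
    then show ?case using M[of \<iota>] by (simp only: lessThan_0 prod.empty mult_1_right)
  next
    case (Suc n)
    have n: "n < N" using Suc by simp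
    note x = Suc.prems(2)
    have xj: "x j \<in> carrier ell1" if "j < N" for j using x that by auto
    have "norm (G (x(n := t))) \<le> (M * (\<Prod>j<n. nrm ell1 (x j))) * nrm ell1 t" if t: "t \<in> carrier ell1" for t
    \<comment> \<open>The crude bound \<open>B\<close> guarantees continuity in the freed
      coordinate; the constant obtained comes from the induction hypothesis.\<close>
    proof (rule ell1_functional_bound[where C = "B * (\<Prod>j\<in>{..<N} - {n}. nrm ell1 (x j))", OF _ _ _ _ t])
      show "G (x(n := s \<oplus>\<^bsub>ell1\<^esub> t)) = G (x(n := s)) + G (x(n := t))"
        if "s \<in> carrier ell1" "t \<in> carrier ell1" for s t
        using bounded_formD(1)[OF G n x that] .
      show "G (x(n := c \<odot>\<^bsub>ell1\<^esub> s)) = c * G (x(n := s))" if "s \<in> carrier ell1" for c s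
        using bounded_formD(2)[OF G n x that] .
      show "norm (G (x(n := t))) \<le> B * (\<Prod>j\<in>{..<N} - {n}. nrm ell1 (x j)) * nrm ell1 t"
        if "t \<in> carrier ell1" for t
      proof -
        have "(\<Prod>j<N. nrm ell1 ((x(n := t)) j)) = nrm ell1 t * (\<Prod>j\<in>{..<N} - {n}. nrm ell1 (x j))"
          using n by (subst prod.remove[of _ n]) (auto intro!: prod.cong)
        then show ?thesis
          using bounded_formD(4)[OF G tuple_upd[where X = ?X, OF x n that]] by (simp add: mult_ac)
      qed
      have "norm (G (x(n := unit_vec i))) \<le> M * (\<Prod>j<n. nrm ell1 ((x(n := unit_vec i)) j))" for i
        by (rule Suc.IH[OF _ tuple_upd[where X = ?X, OF x n unit_vec(1)]]) (use n Suc.prems(3) in auto)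
      then show "norm (G (x(n := unit_vec i))) \<le> M * (\<Prod>j<n. nrm ell1 (x j))" for i
        by simp
    qed
    from this[OF xj[OF n]] show ?case by (simp add: mult_ac)
  qed
  from this[of N] have "norm (G x) \<le> M * (\<Prod>j<N. nrm ell1 (x j))" if "x \<in> tuples N ?X" for x
    using that by simp
  then show ?thesis using G M0 unfolding bounded_form_def by blast
qed

abbreviation coord :: "nat \<Rightarrow> ('k::{real_normed_field,banach}, 'v) point \<Rightarrow> 'k" where
  "coord i \<equiv> coord_sum {i}"

text \<open>An elementary form is the indicator of its own basis tuple, so adding a multiple of it
  changes a form at one basis tuple only.\<close>

lemma prod_coord_basis_tuple:
  "(\<Prod>j<N. coord (\<iota> j) (basis_tuple N \<kappa> j :: ('k::{real_normed_field,banach}, 'v) point)) =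
     (if \<forall>j<N. \<kappa> j = \<iota> j then 1 else 0)"
proof -
  have "coord (\<iota> j) (basis_tuple N \<kappa> j :: ('k, 'v) point) = (if \<kappa> j = \<iota> j then 1 else 0)" if "j < N" for j
    using that by (auto simp: coord_sum_def unit_vec)
  then have "(\<Prod>j<N. coord (\<iota> j) (basis_tuple N \<kappa> j :: ('k, 'v) point)) = (\<Prod>j<N. if \<kappa> j = \<iota> j then 1 else 0)"
    by (intro prod.cong) auto
  then show ?thesis by (auto simp: prod_zero_iff)
qed

text \<open>Perturbing \<open>G\<close> by a multiple of the elementary form at \<open>\<iota>\<close> keeps all its values at basis
  tuples in the unit disc, hence keeps its norm at most 1.  Choosing the phase of the perturbation so
  that it adds up with the value of the extension of \<open>G\<close> gives the estimate.\<close>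

lemma partial_limit_ell1_bound:
  fixes G :: "(nat \<Rightarrow> ('k::{real_normed_field,banach}, 'v) point) \<Rightarrow> 'k"
  assumes "bidual_tuple N (\<lambda>_. ell1) a"
    and G: "bounded_form N (\<lambda>_. ell1) B G" and G1: "\<And>\<kappa>. norm (G (basis_tuple N \<kappa>)) \<le> 1"
    and \<epsilon>: "norm (G (basis_tuple N \<iota>)) \<le> \<epsilon>" "\<epsilon> \<le> 1"
  shows "norm (bidual_tuple.partial_limit N (\<lambda>_. ell1) a G N (\<lambda>_. undefined))
           \<le> 1 - (1 - \<epsilon>) * norm (\<Prod>j<N. a j (coord (\<iota> j)))"
proof -
  let ?X = "\<lambda>_::nat. ell1 :: ('k, 'v) uspace"
  interpret bidual_tuple N ?X a by (rule assms(1))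
  define H where "H x = (\<Prod>j<N. coord (\<iota> j) (x j))" for x :: "nat \<Rightarrow> ('k, 'v) point"
  define w where "w = partial_limit G N (\<lambda>_. undefined)"
  define q where "q = (\<Prod>j<N. a j (coord (\<iota> j)))"
  have H: "bounded_form N ?X 1 H"
    unfolding H_def by (rule bounded_form_prod) (auto intro: nvs_ell1 coord_sum)
  have "partial_limit H N (\<lambda>_. undefined) = q"
    using partial_limit_prod[of "\<lambda>j. coord (\<iota> j)" N "\<lambda>_. undefined"]
    by (simp add: H_def[abs_def] q_def coord_sum lessThan_atLeast0)
  then have pert: "partial_limit (\<lambda>x. G x + c * H x) N (\<lambda>_. undefined) = w + c * q" for c
    using partial_limit_linear[OF G H, of _ c N "\<lambda>_. undefined"] by (simp add: w_def)
  have le: "norm (w + c * q) \<le> 1" if c: "norm c \<le> 1 - \<epsilon>" for c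
  proof -
    have H_basis: "H (basis_tuple N \<kappa>) = (if \<forall>j<N. \<kappa> j = \<iota> j then 1 else 0)" for \<kappa>
      unfolding H_def by (rule prod_coord_basis_tuple)
    have "norm (G (basis_tuple N \<kappa>) + c * H (basis_tuple N \<kappa>)) \<le> 1" for \<kappa>
    proof (cases "\<forall>j<N. \<kappa> j = \<iota> j")
      case True
      then have eq: "(basis_tuple N \<kappa> :: nat \<Rightarrow> ('k, 'v) point) = basis_tuple N \<iota>" by auto
      have "norm (G (basis_tuple N \<iota>) + c) \<le> 1"
        using \<epsilon>(1) c norm_triangle_ineq[of "G (basis_tuple N \<iota>)" c] by linarith
      then show ?thesis unfolding H_basis eq using True by simp
    next
      case False
      then have "H (basis_tuple N \<kappa>) = 0" unfolding H_basis by (rule if_not_P)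
      then show ?thesis using G1 by simp
    qed
    from bounded_form_ell1[OF bounded_form_lincomb[OF G H] this]
    have "bounded_form N ?X 1 (\<lambda>x. G x + c * H x)" .
    \<comment> \<open>After \<open>N\<close> contractions no variable is left, and the constant 1
      bounds the value itself.\<close>
    from bounded_form_partial_limit[OF this, of N] show ?thesis
      by (auto simp: pert[symmetric] bounded_form_def)
  qed
  \<comment> \<open>Here \<open>u\<close> is the phase of \<open>w\<close>, with default 1 at zero,
    and \<open>c\<close> has modulus \<open>1 - \<epsilon>\<close> and turns \<open>q\<close> into
    the direction of \<open>w\<close>, so that the moduli of \<open>w\<close> and
    \<open>c * q\<close> add.\<close>
  define u where "u = (if w = 0 then 1 else w / of_real (norm w))"
  define c where "c = of_real (1 - \<epsilon>) * u * of_real (norm q) / q"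
  have u: "norm u = 1" "w = of_real (norm w) * u" by (auto simp: u_def norm_divide)
  show ?thesis
  proof (cases "q = 0")
    case True
    \<comment> \<open>For \<open>q = 0\<close> the claim is the unperturbed bound, the case
      \<open>c = 0\<close>.\<close>
    then show ?thesis using le[of 0] \<epsilon> by (simp add: w_def[symmetric] q_def[symmetric])
  next
    case False
    have "norm c = 1 - \<epsilon>" using u(1) False \<epsilon>(2) by (simp add: c_def norm_mult norm_divide del: of_real_diff)
    then have "norm (w + c * q) \<le> 1" using le by simp
    moreover have "w + c * q = of_real (norm w + (1 - \<epsilon>) * norm q) * u"
    proof -
      have "c * q = of_real ((1 - \<epsilon>) * norm q) * u"
        using False by (simp add: c_def del: of_real_diff)
      then show ?thesis using u(2) by (simp only: of_real_add distrib_right)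
    qed
    moreover have "norm (of_real (norm w + (1 - \<epsilon>) * norm q) * u) = norm w + (1 - \<epsilon>) * norm q"
      using u(1) \<epsilon>(2) by (simp only: norm_mult norm_of_real) simp
    ultimately show ?thesis by (simp add: w_def[symmetric] q_def[symmetric])
  qed
qed

section \<open>Ideals of multilinear mappings\<close>

abbreviation scalar_prod :: "nat \<Rightarrow> (nat \<Rightarrow> ('k::{real_normed_field,banach}, 'v) point) \<Rightarrow> ('k, 'v) point" where
  "scalar_prod N \<equiv> (\<lambda>z\<in>tuples N (\<lambda>_. scalar_space). Scalar (\<Prod>j<N. the_scalar (z j)))"

lemma normed_idealD:
  fixes U :: "('k::{real_normed_field,banach}, 'v) mclass"
  assumes "normed_ideal N U nU"
  shows "\<And>X Y. (\<And>j. j < N \<Longrightarrow> banach_space (X j)) \<Longrightarrow> banach_space Y \<Longrightarrow>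
           submodule (U X Y) scalars (multilin_space N X Y)"
    and "\<And>X Y. (\<And>j. j < N \<Longrightarrow> banach_space (X j)) \<Longrightarrow> banach_space Y \<Longrightarrow>
           normed_space (ideal_space N U nU X Y)"
    and "\<And>X Z Y W T S \<Phi>. (\<And>j. j < N \<Longrightarrow> banach_space (X j)) \<Longrightarrow> (\<And>j. j < N \<Longrightarrow> banach_space (Z j)) \<Longrightarrow>
           banach_space Y \<Longrightarrow> banach_space W \<Longrightarrow>
           (\<And>j. j < N \<Longrightarrow> T j \<in> carrier (op_space (Z j) (X j))) \<Longrightarrow> S \<in> carrier (op_space Y W) \<Longrightarrow> \<Phi> \<in> U X Y \<Longrightarrow>
           (\<lambda>z\<in>tuples N Z. S (\<Phi> (\<lambda>j\<in>{..<N}. T j (z j)))) \<in> U Z W"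
    and "\<And>X Z Y W T S \<Phi>. (\<And>j. j < N \<Longrightarrow> banach_space (X j)) \<Longrightarrow> (\<And>j. j < N \<Longrightarrow> banach_space (Z j)) \<Longrightarrow>
           banach_space Y \<Longrightarrow> banach_space W \<Longrightarrow>
           (\<And>j. j < N \<Longrightarrow> T j \<in> carrier (op_space (Z j) (X j))) \<Longrightarrow> S \<in> carrier (op_space Y W) \<Longrightarrow> \<Phi> \<in> U X Y \<Longrightarrow>
           nU Z W (\<lambda>z\<in>tuples N Z. S (\<Phi> (\<lambda>j\<in>{..<N}. T j (z j))))
             \<le> nrm (op_space Y W) S * nU X Y \<Phi> * (\<Prod>j<N. nrm (op_space (Z j) (X j)) (T j))"
    and "scalar_prod N \<in> U (\<lambda>_. scalar_space) scalar_space"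
    and "nU (\<lambda>_. scalar_space) scalar_space (scalar_prod N) = 1"
proof -
  note ideal = assms[unfolded normed_ideal_def Let_def]
  note component = ideal[THEN conjunct1, rule_format]
    and composition = ideal[THEN conjunct2, THEN conjunct1, rule_format]
    and product = ideal[THEN conjunct2, THEN conjunct2]
  show "submodule (U X Y) scalars (multilin_space N X Y)"
    and "normed_space (ideal_space N U nU X Y)"
    if "\<And>j. j < N \<Longrightarrow> banach_space (X j)" "banach_space Y" for X Y
    using component[of X Y] that by simp_all
  show "(\<lambda>z\<in>tuples N Z. S (\<Phi> (\<lambda>j\<in>{..<N}. T j (z j)))) \<in> U Z W"
    and "nU Z W (\<lambda>z\<in>tuples N Z. S (\<Phi> (\<lambda>j\<in>{..<N}. T j (z j))))
      \<le> nrm (op_space Y W) S * nU X Y \<Phi> * (\<Prod>j<N. nrm (op_space (Z j) (X j)) (T j))"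
    if "\<And>j. j < N \<Longrightarrow> banach_space (X j)" "\<And>j. j < N \<Longrightarrow> banach_space (Z j)"
      "banach_space Y" "banach_space W" "\<And>j. j < N \<Longrightarrow> T j \<in> carrier (op_space (Z j) (X j))"
      "S \<in> carrier (op_space Y W)" "\<Phi> \<in> U X Y"
    for X Z Y W T S \<Phi>
  proof -
    have "(\<forall>j<N. banach_space (X j) \<and> banach_space (Z j)) \<and> banach_space Y \<and> banach_space W \<and>
        (\<forall>j<N. T j \<in> carrier (op_space (Z j) (X j))) \<and> S \<in> carrier (op_space Y W) \<and> \<Phi> \<in> U X Y"
      using that by blast
    note composition[OF this]
    then show "(\<lambda>z\<in>tuples N Z. S (\<Phi> (\<lambda>j\<in>{..<N}. T j (z j)))) \<in> U Z W"
      and "nU Z W (\<lambda>z\<in>tuples N Z. S (\<Phi> (\<lambda>j\<in>{..<N}. T j (z j))))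
        \<le> nrm (op_space Y W) S * nU X Y \<Phi> * (\<Prod>j<N. nrm (op_space (Z j) (X j)) (T j))"
      by (rule conjunct1, rule conjunct2)
  qed
  show "scalar_prod N \<in> U (\<lambda>_. scalar_space) scalar_space"
    and "nU (\<lambda>_. scalar_space) scalar_space (scalar_prod N) = 1"
    by (rule product[THEN conjunct1], rule product[THEN conjunct2])
qed

lemma ideal_space_simps [simp]:
  "carrier (ideal_space N U nU X Y) = U X Y" "nrm (ideal_space N U nU X Y) = nU X Y"
  "add (ideal_space N U nU X Y) = (\<lambda>\<Phi> \<Psi>. \<lambda>x\<in>tuples N X. \<Phi> x \<oplus>\<^bsub>Y\<^esub> \<Psi> x)"
  "smult (ideal_space N U nU X Y) = (\<lambda>c \<Phi>. \<lambda>x\<in>tuples N X. c \<odot>\<^bsub>Y\<^esub> \<Phi> x)"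
  "ring.zero (ideal_space N U nU X Y) = (\<lambda>x\<in>tuples N X. \<zero>\<^bsub>Y\<^esub>)"
  by (simp_all add: ideal_space_def multilin_space_def)

lemma ideal_subset_multilin:
  assumes "normed_ideal N U nU" "\<And>j. j < N \<Longrightarrow> banach_space (X j)" "banach_space Y" "\<Phi> \<in> U X Y"
  shows "\<Phi> \<in> carrier (multilin_space N X Y)"
proof -
  interpret S: submodule "U X Y" scalars "multilin_space N X Y"
    by (rule normed_idealD(1)[OF assms(1-3)])
  show ?thesis using S.subset assms(4) by auto
qed

text \<open>The ideal norm dominates all values on the unit ball, seen through functionals of norm
  at most one. Composing with the lines through the entries of \<open>x\<close> and with
  \<open>f\<close> gives \<open>f (\<Phi> x)\<close> times the product of scalars, which has ideal
  norm one, while the composition inequality bounds the ideal norm of the composite.\<close>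

lemma ideal_functional_le:
  fixes U :: "('k::{real_normed_field,banach}, 'v) mclass"
  assumes I: "normed_ideal N U nU" and X: "\<And>j. j < N \<Longrightarrow> banach_space (X j)" and Y: "banach_space Y"
    and \<Phi>: "\<Phi> \<in> U X Y" and f: "f \<in> carrier (dual Y)" "nrm (dual Y) f \<le> 1"
    and x: "x \<in> tuples N X" "\<And>j. j < N \<Longrightarrow> nrm (X j) (x j) \<le> 1"
  shows "norm (f (\<Phi> x)) \<le> nU X Y \<Phi>"
proof -
  let ?K = "scalar_space :: ('k, 'v) uspace"
  interpret Y: nvs Y by (rule banach_space_nvs[OF Y])
  have nvs_X: "nvs (X j)" if "j < N" for j by (rule banach_space_nvs[OF X[OF that]])
  interpret T: nvs_tuple N X Y
    by (intro nvs_tuple.intro Y.nvs_axioms nvs_tuple_axioms.intro nvs_X)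
  interpret IK: nvs "ideal_space N U nU (\<lambda>_. ?K) ?K"
    by (rule nvsI, rule normed_idealD(2)[OF I]) (rule banach_space_scalar_space)+
  interpret IX: nvs "ideal_space N U nU X Y"
    by (rule nvsI, rule normed_idealD(2)[OF I X Y])
  have \<Phi>m: "\<Phi> \<in> carrier (multilin_space N X Y)" by (rule ideal_subset_multilin[OF I X Y \<Phi>])
  have xj: "x j \<in> carrier (X j)" if "j < N" for j using PiE_mem[OF x(1)] that by simp
  define \<Theta> where "\<Theta> = (\<lambda>z\<in>tuples N (\<lambda>_. ?K).
    functional_op Y f (\<Phi> (\<lambda>j\<in>{..<N}. scalar_mult_op (X j) (x j) (z j))) :: ('k, 'v) point)"
  have T: "scalar_mult_op (X j) (x j) \<in> carrier (op_space ?K (X j))"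
    "nrm (op_space ?K (X j)) (scalar_mult_op (X j) (x j)) \<le> 1" if "j < N" for j
    using nvs.scalar_mult_op[OF nvs_X xj] x(2) that order_trans by blast+
  have S: "functional_op Y f \<in> carrier (op_space Y ?K)" "nrm (op_space Y ?K) (functional_op Y f) \<le> 1"
    using Y.functional_op[OF f(1)] f(2) order_trans by blast+
  have T0: "0 \<le> nrm (op_space ?K (X j)) (scalar_mult_op (X j) (x j))" if "j < N" for j
    using nvs_pair.op_nrm_nonneg[OF _ T(1)[OF that]] nvs_X[OF that] nvs_scalar_space by (simp add: nvs_pair_def)
  have S0: "0 \<le> nrm (op_space Y ?K) (functional_op Y f)"
    using nvs_pair.op_nrm_nonneg[OF _ S(1)] nvs_scalar_space Y.nvs_axioms by (simp add: nvs_pair_def)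
  \<comment> \<open>Multilinearity pulls the scalars out of all coordinates at once.\<close>
  have "\<Theta> = f (\<Phi> x) \<odot>\<^bsub>ideal_space N U nU (\<lambda>_. ?K) ?K\<^esub> scalar_prod N"
    unfolding \<Theta>_def ideal_space_simps
  proof (rule restrict_ext)
    fix z assume z: "z \<in> tuples N (\<lambda>_. ?K)"
    have "(\<lambda>j\<in>{..<N}. scalar_mult_op (X j) (x j) (z j)) = (\<lambda>j\<in>{..<N}. the_scalar (z j) \<odot>\<^bsub>X j\<^esub> x j)"
      using PiE_mem[OF z] by (intro restrict_ext) (simp add: scalar_mult_op_def)
    then have "\<Phi> (\<lambda>j\<in>{..<N}. scalar_mult_op (X j) (x j) (z j)) = (\<Prod>j<N. the_scalar (z j)) \<odot>\<^bsub>Y\<^esub> \<Phi> x"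
      using T.multilin_scale[OF \<Phi>m x(1), of "\<lambda>j. the_scalar (z j)"] by simp
    moreover have "\<Phi> x \<in> carrier Y" by (rule multilin_spaceD(2)[OF \<Phi>m x(1)])
    ultimately show "functional_op Y f (\<Phi> (\<lambda>j\<in>{..<N}. scalar_mult_op (X j) (x j) (z j))) =
        f (\<Phi> x) \<odot>\<^bsub>?K\<^esub> scalar_prod N z"
      using z Y.dualD(3)[OF f(1)] by (simp add: functional_op_def scalar_space_simps(4) mult.commute)
  qed
  then have "nU (\<lambda>_. ?K) ?K \<Theta> = norm (f (\<Phi> x)) * nU (\<lambda>_. ?K) ?K (scalar_prod N)"
    using IK.nrm_smult[of "scalar_prod N" "f (\<Phi> x)"] normed_idealD(5)[OF I] by simp
  then have "norm (f (\<Phi> x)) = nU (\<lambda>_. ?K) ?K \<Theta>"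
    by (simp add: normed_idealD(6)[OF I])
  also have "\<dots> \<le> nrm (op_space Y ?K) (functional_op Y f) * nU X Y \<Phi> *
      (\<Prod>j<N. nrm (op_space ?K (X j)) (scalar_mult_op (X j) (x j)))"
    unfolding \<Theta>_def
    by (rule normed_idealD(4)[OF I X banach_space_scalar_space Y banach_space_scalar_space T(1) S(1) \<Phi>])
  also have "\<dots> \<le> 1 * nU X Y \<Phi> * 1"
  proof (intro mult_mono)
    show "(\<Prod>j<N. nrm (op_space ?K (X j)) (scalar_mult_op (X j) (x j))) \<le> 1"
      by (rule prod_le_1) (use T(2) T0 in auto)
    show "0 \<le> (\<Prod>j<N. nrm (op_space ?K (X j)) (scalar_mult_op (X j) (x j)))"
      by (rule prod_nonneg) (use T0 in auto)
  qed (use IX.nrm_nonneg[of \<Phi>] \<Phi> S S0 in auto)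
  finally show ?thesis by simp
qed

text \<open>The mapping is the product of scalars preceded by coordinate functionals and followed by
  the line through \<open>y\<close>.\<close>

lemma elementary_in_ideal:
  fixes U :: "('k::{real_normed_field,banach}, 'v) mclass"
  assumes I: "normed_ideal N U nU" and Y: "banach_space Y" and y: "y \<in> carrier Y"
  shows "(\<lambda>z\<in>tuples N (\<lambda>_. ell1). (\<Prod>k<N. coord (\<iota> k) (z k)) \<odot>\<^bsub>Y\<^esub> y) \<in> U (\<lambda>_. ell1) Y"
proof -
  let ?K = "scalar_space :: ('k, 'v) uspace"
  interpret Y: nvs Y by (rule banach_space_nvs[OF Y])
  interpret E: nvs "ell1 :: ('k, 'v) uspace" by (rule nvs_ell1)
  have "(\<lambda>z\<in>tuples N (\<lambda>_. ell1 :: ('k, 'v) uspace). (\<Prod>k<N. coord (\<iota> k) (z k)) \<odot>\<^bsub>Y\<^esub> y) =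
      (\<lambda>z\<in>tuples N (\<lambda>_. ell1).
         scalar_mult_op Y y (scalar_prod N (\<lambda>k\<in>{..<N}. functional_op ell1 (coord (\<iota> k)) (z k)) :: ('k, 'v) point))"
  proof (rule restrict_ext)
    fix z assume z: "z \<in> tuples N (\<lambda>_. ell1 :: ('k, 'v) uspace)"
    have zk: "functional_op ell1 (coord (\<iota> k)) (z k) = (Scalar (coord (\<iota> k) (z k)) :: ('k, 'v) point)" if "k < N" for k
      using PiE_mem[OF z] that by (simp add: functional_op_def)
    then have "(\<lambda>k\<in>{..<N}. functional_op ell1 (coord (\<iota> k)) (z k)) \<in> tuples N (\<lambda>_. ?K)"
      by (intro restrict_PiE_iff[THEN iffD2] ballI) (simp add: scalar_space_simps(1))
    then show "(\<Prod>k<N. coord (\<iota> k) (z k)) \<odot>\<^bsub>Y\<^esub> y =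
        scalar_mult_op Y y (scalar_prod N (\<lambda>k\<in>{..<N}. functional_op ell1 (coord (\<iota> k)) (z k)) :: ('k, 'v) point)"
      by (simp add: zk scalar_mult_op_def scalar_space_simps(1))
  qed
  moreover have "\<dots> \<in> U (\<lambda>_. ell1) Y"
    by (rule normed_idealD(3)[OF I banach_space_scalar_space banach_space_ell1 banach_space_scalar_space Y
          _ Y.scalar_mult_op(1)[OF y] normed_idealD(5)[OF I]])
      (intro E.functional_op coord_sum, simp)
  ultimately show ?thesis by (simp only:)
qed

text \<open>Components of an ideal are subspaces, so they contain finite sums of elementary
  mappings; hence the counterexample lies in every ideal.\<close>

lemma finite_type_in_ideal:
  fixes U :: "('k::{real_normed_field,banach}, 'v) mclass"
  assumes I: "normed_ideal N U nU" and Y: "banach_space Y" and y: "y \<in> carrier Y" and J: "finite J"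
  shows "(\<lambda>z\<in>tuples N (\<lambda>_. ell1). (\<Sum>s\<in>J. \<Prod>k<N. coord (\<iota> s k) (z k)) \<odot>\<^bsub>Y\<^esub> y) \<in> U (\<lambda>_. ell1) Y"
proof -
  interpret Y: nvs Y by (rule banach_space_nvs[OF Y])
  interpret I: nvs "ideal_space N U nU (\<lambda>_. ell1) Y"
    by (rule nvsI, rule normed_idealD(2)[OF I banach_space_ell1 Y])
  show ?thesis
    using J
  proof induction
    case empty
    have "(\<lambda>z\<in>tuples N (\<lambda>_. ell1). (\<Sum>s\<in>{}. \<Prod>k<N. coord (\<iota> s k) (z k)) \<odot>\<^bsub>Y\<^esub> y) =
        \<zero>\<^bsub>ideal_space N U nU (\<lambda>_. ell1) Y\<^esub>"
      unfolding ideal_space_simps by (rule restrict_ext) (use y in simp)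
    then show ?case using I.zero_in by (simp only: ideal_space_simps(1))
  next
    case (insert s J)
    have "(\<lambda>z\<in>tuples N (\<lambda>_. ell1). (\<Sum>s\<in>insert s J. \<Prod>k<N. coord (\<iota> s k) (z k)) \<odot>\<^bsub>Y\<^esub> y) =
       (\<lambda>z\<in>tuples N (\<lambda>_. ell1). (\<Prod>k<N. coord (\<iota> s k) (z k)) \<odot>\<^bsub>Y\<^esub> y) \<oplus>\<^bsub>ideal_space N U nU (\<lambda>_. ell1) Y\<^esub>
       (\<lambda>z\<in>tuples N (\<lambda>_. ell1). (\<Sum>s\<in>J. \<Prod>k<N. coord (\<iota> s k) (z k)) \<odot>\<^bsub>Y\<^esub> y)"
      unfolding ideal_space_simps by (rule restrict_ext) (use insert y in \<open>simp add: Y.smult_add_left\<close>)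
    moreover have "\<dots> \<in> U (\<lambda>_. ell1) Y"
      using I.add_in[unfolded ideal_space_simps(1), OF elementary_in_ideal[OF I Y y] insert.IH] .
    ultimately show ?case by (simp only:)
  qed
qed

section \<open>The counterexample\<close>

definition avg :: "nat \<Rightarrow> ('k::{real_normed_field,banach}, 'v) point" where
  "avg m = Seq (\<lambda>n. if n < m then 1 / of_nat m else 0)"

lemma avg:
  assumes "m > 0"
  shows "(avg m :: ('k::{real_normed_field,banach}, 'v) point) \<in> carrier ell1"
    and "nrm ell1 (avg m :: ('k, 'v) point) = 1"
proof -
  have "(\<lambda>n. norm (the_seq (avg m :: ('k, 'v) point) n)) sums
      (\<Sum>n<m. norm (the_seq (avg m :: ('k, 'v) point) n))"
    by (rule sums_finite) (auto simp: avg_def)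
  moreover have "(\<Sum>n<m. norm (the_seq (avg m :: ('k, 'v) point) n)) = 1"
    using assms by (simp add: avg_def norm_divide)
  ultimately have "(\<lambda>n. norm (the_seq (avg m :: ('k, 'v) point) n)) sums 1" by (simp only:)
  then show "(avg m :: ('k, 'v) point) \<in> carrier ell1" "nrm ell1 (avg m :: ('k, 'v) point) = 1"
    by (simp_all add: ell1_simps(1,5) sums_iff) (simp add: avg_def)
qed

lemma coord_sum_avg:
  assumes "m > 0" "P \<subseteq> {..<m}"
  shows "coord_sum P (avg m :: ('k::{real_normed_field,banach}, 'v) point) = of_nat (card P) / of_nat m"
proof -
  have "(\<Sum>i\<in>P. the_seq (avg m :: ('k, 'v) point) i) = (\<Sum>i\<in>P. 1 / of_nat m)"
    by (intro sum.cong) (use assms in \<open>auto simp: avg_def\<close>)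
  moreover have "(avg m :: ('k, 'v) point) \<in> carrier ell1" by (rule avg(1)[OF assms(1)])
  ultimately show ?thesis by (simp add: coord_sum_def)
qed

text \<open>The form is essentially bilinear: all coordinates from the third on are tested at index
  0, matching the unit vectors placed there by \<open>avg_tuple\<close>.\<close>

definition pair_index :: "nat \<times> nat \<Rightarrow> nat \<Rightarrow> nat" where
  "pair_index s k = (if k = 0 then fst s else if k = 1 then snd s else 0)"

definition off_diagonal :: "nat \<Rightarrow> (nat \<times> nat) set" where
  "off_diagonal m = {..<m} \<times> {..<m} - (\<lambda>i. (i, i)) ` {..<m}"

definition off_diagonal_form ::
  "nat \<Rightarrow> nat \<Rightarrow> (nat \<Rightarrow> ('k::{real_normed_field,banach}, 'v) point) \<Rightarrow> 'k" where
  "off_diagonal_form N m z = (\<Sum>s\<in>off_diagonal m. \<Prod>k<N. coord (pair_index s k) (z k))"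

lemma finite_off_diagonal [simp]: "finite (off_diagonal m)"
  by (simp add: off_diagonal_def)

lemma card_off_diagonal: "card (off_diagonal m) = m * m - m"
proof -
  have "card (off_diagonal m) = card ({..<m} \<times> {..<m}) - card ((\<lambda>i. (i, i)) ` {..<m})"
    unfolding off_diagonal_def by (rule card_Diff_subset) auto
  moreover have "card ((\<lambda>i. (i, i)) ` {..<m}) = m"
    by (subst card_image) (auto simp: inj_on_def)
  ultimately show ?thesis by (simp add: card_cartesian_product)
qed

text \<open>At a basis tuple at most one elementary summand survives, the one whose pair consists of
  the first two indices. So all basis values are 0 or 1, and they vanish on the diagonal.\<close>

lemma off_diagonal_form_basis:
  assumes "N \<ge> 2"
  shows "off_diagonal_form N m (basis_tuple N \<kappa> :: nat \<Rightarrow> ('k::{real_normed_field,banach}, 'v) point) =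
    (if (\<kappa> 0, \<kappa> 1) \<in> off_diagonal m \<and> (\<forall>k<N. 2 \<le> k \<longrightarrow> \<kappa> k = 0) then 1 else 0)"
proof -
  have "(\<forall>k<N. \<kappa> k = pair_index s k) \<longleftrightarrow> s = (\<kappa> 0, \<kappa> 1) \<and> (\<forall>k<N. 2 \<le> k \<longrightarrow> \<kappa> k = 0)" for s
  proof
    assume *: "\<forall>k<N. \<kappa> k = pair_index s k"
    then have "\<kappa> 0 = fst s" "\<kappa> 1 = snd s" using assms by (auto simp: pair_index_def)
    moreover have "\<forall>k<N. 2 \<le> k \<longrightarrow> \<kappa> k = 0" using * by (auto simp: pair_index_def)
    ultimately show "s = (\<kappa> 0, \<kappa> 1) \<and> (\<forall>k<N. 2 \<le> k \<longrightarrow> \<kappa> k = 0)" by (simp add: prod_eq_iff)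
  next
    assume *: "s = (\<kappa> 0, \<kappa> 1) \<and> (\<forall>k<N. 2 \<le> k \<longrightarrow> \<kappa> k = 0)"
    then show "\<forall>k<N. \<kappa> k = pair_index s k"
      by (auto simp: pair_index_def)
  qed
  then have "off_diagonal_form N m (basis_tuple N \<kappa> :: nat \<Rightarrow> ('k, 'v) point) =
      (\<Sum>s\<in>off_diagonal m. if s = (\<kappa> 0, \<kappa> 1) then if \<forall>k<N. 2 \<le> k \<longrightarrow> \<kappa> k = 0 then 1 else 0 else 0)"
    unfolding off_diagonal_form_def prod_coord_basis_tuple by (intro sum.cong) auto
  then show ?thesis by (simp add: sum.delta' sum.delta)
qed

text \<open>A finite sum of elementary forms has some bound, and \<open>bounded_form_ell1\<close>
  sharpens it to 1 since the basis values are 0 or 1.\<close>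

lemma bounded_form_off_diagonal:
  assumes "N \<ge> 2"
  shows "bounded_form N (\<lambda>_. ell1) 1 (off_diagonal_form N m :: (nat \<Rightarrow> ('k::{real_normed_field,banach}, 'v) point) \<Rightarrow> 'k)"
proof -
  have "\<exists>B. bounded_form N (\<lambda>_. ell1) B
      (\<lambda>z :: nat \<Rightarrow> ('k, 'v) point. \<Sum>s\<in>J. \<Prod>k<N. coord (pair_index s k) (z k))" if "finite J" for J
    using that
  proof induction
    case empty
    show ?case by (rule exI[of _ 0]) (simp add: bounded_form_def)
  next
    case (insert s J)
    then obtain B where B: "bounded_form N (\<lambda>_. ell1) B
      (\<lambda>z :: nat \<Rightarrow> ('k, 'v) point. \<Sum>s\<in>J. \<Prod>k<N. coord (pair_index s k) (z k))" by blast
    have "bounded_form N (\<lambda>_. ell1) 1 (\<lambda>z :: nat \<Rightarrow> ('k, 'v) point. \<Prod>k<N. coord (pair_index s k) (z k))"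
      by (rule bounded_form_prod) (simp_all add: nvs_ell1 coord_sum)
    from bounded_form_lincomb[OF this B, of 1] insert show ?case by auto
  qed
  from this[OF finite_off_diagonal] obtain B where
    "bounded_form N (\<lambda>_. ell1) B (off_diagonal_form N m :: (nat \<Rightarrow> ('k, 'v) point) \<Rightarrow> 'k)"
    unfolding off_diagonal_form_def[abs_def] by blast
  then show ?thesis
    by (rule bounded_form_ell1) (simp only: off_diagonal_form_basis[OF assms], simp)
qed

definition avg_tuple :: "nat \<Rightarrow> nat \<Rightarrow> nat \<Rightarrow> ('k::{real_normed_field,banach}, 'v) point" where
  "avg_tuple N m = (\<lambda>k\<in>{..<N}. if k < 2 then avg m else unit_vec 0)"

text \<open>Each of the \<open>m * m - m\<close> pairs contributes \<open>1 / m\<close> twice as a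
  factor, and the factors from the third on are 1.\<close>

lemma off_diagonal_form_avg_tuple:
  assumes N: "N \<ge> 2" and m: "m > 0"
  shows "off_diagonal_form N m (avg_tuple N m :: nat \<Rightarrow> ('k::{real_normed_field,banach}, 'v) point) = of_real (1 - 1 / real m)"
proof -
  define n where "n = N - 2"
  then have n: "N = Suc (Suc n)" using N by simp
  have "(\<Prod>k<N. coord (pair_index s k) (avg_tuple N m k :: ('k, 'v) point)) = 1 / of_nat m * (1 / of_nat m)"
    if "s \<in> off_diagonal m" for s
  proof -
    have s: "fst s < m" "snd s < m" using that by (auto simp: off_diagonal_def)
    have "coord (pair_index s 0) (avg_tuple N m 0 :: ('k, 'v) point) = 1 / of_nat m"
      "coord (pair_index s (Suc 0)) (avg_tuple N m (Suc 0) :: ('k, 'v) point) = 1 / of_nat m"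
      using coord_sum_avg[OF m, of "{fst s}"] coord_sum_avg[OF m, of "{snd s}"] s n
      by (simp_all add: pair_index_def avg_tuple_def)
    moreover have "coord (pair_index s (Suc (Suc k))) (avg_tuple N m (Suc (Suc k)) :: ('k, 'v) point) = 1" if "k < n" for k
      using that n by (simp add: pair_index_def avg_tuple_def coord_sum_def unit_vec(1))
    ultimately show ?thesis by (simp add: n prod.lessThan_Suc_shift del: prod.lessThan_Suc)
  qed
  then have "off_diagonal_form N m (avg_tuple N m :: nat \<Rightarrow> ('k, 'v) point) =
      of_nat (m * m - m) * (1 / of_nat m * (1 / of_nat m))"
    unfolding off_diagonal_form_def by (simp add: card_off_diagonal)
  also have "\<dots> = of_real (real (m * m - m) * (1 / real m * (1 / real m)))"
    by simp
  also have "real (m * m - m) * (1 / real m * (1 / real m)) = 1 - 1 / real m"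
    using m by (simp add: of_nat_diff field_simps)
  finally show ?thesis .
qed

text \<open>If the first two coordinates of a tuple in the bidual had disjoint supports within the first
  \<open>m\<close> coordinates, one of them would vanish on at least half of these and hence have distance at
  least \<open>1/2\<close> from the uniform distribution.\<close>

lemma common_support:
  fixes a :: "nat \<Rightarrow> (('k::{real_normed_field,banach}, 'v) point \<Rightarrow> 'k) \<Rightarrow> 'k"
  assumes "bidual_tuple N (\<lambda>_. ell1) a" and N: "N \<ge> 2" and m: "m > 0"
    and near: "\<And>k P. k < N \<Longrightarrow> finite P \<Longrightarrow> norm (a k (coord_sum P) - coord_sum P (avg_tuple N m k :: ('k, 'v) point)) < 1 / 2"
  obtains i where "i < m" "(\<Prod>k<N. a k (coord (pair_index (i, i) k))) \<noteq> 0"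
proof -
  let ?X = "\<lambda>_::nat. ell1 :: ('k, 'v) uspace"
  interpret bidual_tuple N ?X a by (rule assms(1))
  \<comment> \<open>Links the mass on a set, which nearness controls, with the single coordinates
    whose vanishing matters.\<close>
  have sum: "a k (coord_sum P) = (\<Sum>i\<in>P. a k (coord i))" if "k < N" "finite P" for k P
    using that(2)
  proof induction
    case empty
    have "(coord_sum {} :: ('k, 'v) point \<Rightarrow> 'k) = (\<lambda>x\<in>carrier ell1. 0 * coord_sum {} x)"
      unfolding coord_sum_def by (rule restrict_ext) simp
    then have "a k (coord_sum {}) = 0 * a k (coord_sum {})"
      using a_apply(2)[OF that(1) coord_sum(1)[of "{}"], of 0] by simp
    then show ?case by simp
  next
    case (insert i P)
    have "(coord_sum (insert i P) :: ('k, 'v) point \<Rightarrow> 'k) = (\<lambda>x\<in>carrier ell1. coord i x + coord_sum P x)"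
      unfolding coord_sum_def by (rule restrict_ext) (use insert in simp)
    then have "a k (coord_sum (insert i P)) = a k (coord i) + a k (coord_sum P)"
      using a_apply(1)[OF that(1) coord_sum(1)[of "{i}"] coord_sum(1)[of P]] insert by (simp only: finite.intros)
    then show ?case using insert by simp
  qed
  \<comment> \<open>On the set where \<open>a k\<close> vanishes, the uniform distribution has mass
    \<open>card / m\<close>; nearness forces this below \<open>1/2\<close>.\<close>
  have small: "card {i. i < m \<and> a k (coord i) = 0} < real m / 2" if "k < 2" for k
  proof -
    let ?P = "{i. i < m \<and> a k (coord i) = 0}"
    have k: "k < N" using that N by simp
    have "a k (coord_sum ?P) = 0" using sum[OF k, of ?P] by simp
    moreover have "coord_sum ?P (avg_tuple N m k :: ('k, 'v) point) = of_nat (card ?P) / of_nat m"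
      using k that coord_sum_avg[OF m, of ?P] by (auto simp: avg_tuple_def)
    ultimately have "norm (of_nat (card ?P) / of_nat m :: 'k) < 1 / 2"
      using near[OF k, of ?P] by simp
    then show ?thesis using m by (simp add: norm_divide field_simps)
  qed
  \<comment> \<open>Two sets of fewer than \<open>m / 2\<close> indices each cannot cover all
    \<open>m\<close> indices.\<close>
  have "\<exists>i<m. a 0 (coord i) \<noteq> 0 \<and> a 1 (coord i) \<noteq> 0"
  proof (rule ccontr)
    assume "\<not> ?thesis"
    then have "{..<m} \<subseteq> {i. i < m \<and> a 0 (coord i) = 0} \<union> {i. i < m \<and> a 1 (coord i) = 0}" by auto
    then have "m \<le> card ({i. i < m \<and> a 0 (coord i) = 0} \<union> {i. i < m \<and> a 1 (coord i) = 0})"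
      using card_mono[of _ "{..<m}"] by fastforce
    also have "\<dots> \<le> card {i. i < m \<and> a 0 (coord i) = 0} + card {i. i < m \<and> a 1 (coord i) = 0}"
      by (rule card_Un_le)
    finally show False using small[of 0] small[of 1] by simp
  qed
  then obtain i where i: "i < m" "a 0 (coord i) \<noteq> 0" "a 1 (coord i) \<noteq> 0" by blast
  have "a k (coord (pair_index (i, i) k)) \<noteq> 0" if k: "k < N" for k
  proof -
    consider "k = 0" | "k = 1" | "k \<ge> 2" by linarith
    then show ?thesis
    proof cases
      case 3
      \<comment> \<open>Later entries of the point are \<open>unit_vec 0\<close>, so
        \<open>a k\<close> at coordinate 0 is within \<open>1/2\<close> of 1.\<close>
      then have "coord 0 (avg_tuple N m k :: ('k, 'v) point) = 1"
        using k by (simp add: avg_tuple_def coord_sum_def unit_vec(1))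
      then have "norm (a k (coord 0) - 1) < 1 / 2" using near[OF k, of "{0}"] by simp
      then have "a k (coord 0) \<noteq> 0" by auto
      then show ?thesis using 3 by (simp add: pair_index_def)
    qed (use i in \<open>auto simp: pair_index_def\<close>)
  qed
  then show ?thesis using that[OF i(1)] by simp
qed

theorem proposition4p3:
  fixes N :: nat
    and U :: "('k::{real_normed_field,banach}, 'v) mclass"
    and nU :: "('k, 'v) mnorm"
    and Y :: "('k, 'v) uspace"
  assumes "N \<ge> 2"
    and "banach_ideal N U nU"
    and "banach_space Y"
    and "carrier Y \<noteq> {\<zero>\<^bsub>Y\<^esub>}"
  shows "\<not> LBp N U nU (\<lambda>_. ell1) Y"
proof
  let ?E = "ell1 :: ('k, 'v) uspace"
  let ?X = "\<lambda>_::nat. ?E"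
  assume "LBp N U nU ?X Y"
  then obtain \<beta> \<eta> :: "real \<Rightarrow> real" where pos: "\<forall>\<epsilon>>0. \<beta> \<epsilon> > 0 \<and> \<eta> \<epsilon> > 0"
    and \<beta>: "(\<beta> \<longlongrightarrow> 0) (at_right 0)"
    and LB: "\<forall>\<epsilon>>0. \<forall>\<Phi>\<in>U ?X Y. \<forall>x \<in> (\<Pi>\<^sub>E j\<in>{..<N}. unit_sphere ?E).
           nrm (multilin_space N ?X Y) \<Phi> = 1 \<and> nrm Y (\<Phi> x) > 1 - \<eta> \<epsilon> \<longrightarrow>
           (\<exists>\<Psi>\<in>U ?X Y. \<exists>\<Psi>''. \<exists>a \<in> (\<Pi>\<^sub>E j\<in>{..<N}. unit_sphere (bidual ?E)).
              nrm (multilin_space N ?X Y) \<Psi> = 1 \<and>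
              arens_extension N ?X Y \<Psi> \<Psi>'' \<and> nrm (bidual Y) (\<Psi>'' a) = 1 \<and>
              Max ((\<lambda>j. nrm (bidual ?E) (a j \<ominus>\<^bsub>bidual ?E\<^esub> canon ?E (x j))) ` {..<N}) < \<beta> \<epsilon> \<and>
              nrm (ideal_space N U nU ?X Y) (\<Psi> \<ominus>\<^bsub>ideal_space N U nU ?X Y\<^esub> \<Phi>) < \<epsilon>)"
    unfolding LBp_def by (elim exE conjE) (rule that; assumption)
  have N: "N > 0" using assms(1) by simp
  have I: "normed_ideal N U nU" using assms(2) by (simp add: banach_ideal_def)
  note Y = assms(3)
  interpret Y: nvs Y by (rule banach_space_nvs[OF Y])
  interpret YY: nvs "dual Y" by (rule nvs_dual[OF Y.nvs_axioms])
  interpret E: nvs ?E by (rule nvs_ell1)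
  interpret EE: nvs "dual ?E" by (rule nvs_dual[OF nvs_ell1])
  interpret EEE: nvs "bidual ?E" by (rule nvs_dual[OF nvs_dual[OF nvs_ell1]])
  interpret T: nvs_tuple N ?X Y
    by (intro nvs_tuple.intro Y.nvs_axioms nvs_tuple_axioms.intro nvs_ell1)
  interpret I: nvs "ideal_space N U nU ?X Y"
    by (rule nvsI, rule normed_idealD(2)[OF I banach_space_ell1 Y])
  \<comment> \<open>The bound \<open>1/2\<close> on \<open>\<beta> \<epsilon>\<close> gives a common
    support; \<open>\<epsilon> < 1\<close> leaves room to enlarge a diagonal value.\<close>
  have "eventually (\<lambda>\<epsilon>. \<beta> \<epsilon> < 1 / 2 \<and> 0 < \<epsilon> \<and> \<epsilon> < 1) (at_right 0)"
    by (rule eventually_mono[OF eventually_conj[OF order_tendstoD(2)[OF \<beta>, of "1 / 2"] eventually_at_right_real[of 0 1]]]) auto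
  then obtain \<epsilon> where \<epsilon>: "\<beta> \<epsilon> < 1 / 2" "0 < \<epsilon>" "\<epsilon> < 1"
    using eventually_happens'[OF trivial_limit_at_right_real] by blast
  \<comment> \<open>The bound \<open>m \<ge> 2\<close> provides an off-diagonal pair, so that norm
    one is attained; \<open>1 / m < \<eta> \<epsilon>\<close> puts the value at the uniform
    distribution above the threshold.\<close>
  obtain m :: nat where m: "m \<ge> 2" "1 / real m < \<eta> \<epsilon>"
  proof -
    obtain n :: nat where n: "1 / \<eta> \<epsilon> < real n" using reals_Archimedean2 by blast
    have "\<eta> \<epsilon> > 0" using pos \<epsilon>(2) by blast
    then have "1 < \<eta> \<epsilon> * real (n + 2)" using n by (simp add: field_simps)
    then show ?thesis by (intro that[of "n + 2"]) (auto simp: field_simps)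
  qed
  then have m0: "m > 0" by simp
  obtain y where y: "y \<in> carrier Y" "nrm Y y = 1"
  proof -
    obtain y where y: "y \<in> carrier Y" "y \<noteq> \<zero>\<^bsub>Y\<^esub>" using assms(4) Y.zero_in by blast
    then have "nrm Y y > 0" using Y.nrm_nonneg Y.nrm_eq_0 by (metis less_eq_real_def)
    then have "norm (of_real (inverse (nrm Y y)) :: 'k) * nrm Y y = 1" unfolding norm_of_real by simp
    then show ?thesis
      using y by (intro that[of "of_real (inverse (nrm Y y)) \<odot>\<^bsub>Y\<^esub> y"]) simp_all
  qed
  define A :: "(nat \<Rightarrow> ('k, 'v) point) \<Rightarrow> 'k" where "A = off_diagonal_form N m"
  define \<Phi> where "\<Phi> = (\<lambda>z\<in>tuples N ?X. A z \<odot>\<^bsub>Y\<^esub> y)"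
  have \<Phi>: "\<Phi> \<in> U ?X Y"
    using finite_type_in_ideal[OF I Y y(1) finite_off_diagonal, of pair_index m]
    unfolding \<Phi>_def A_def off_diagonal_form_def[abs_def] .
  have A: "bounded_form N ?X 1 A" unfolding A_def by (rule bounded_form_off_diagonal[OF assms(1)])
  have nrm_\<Phi>_apply: "nrm Y (\<Phi> z) = norm (A z)" if "z \<in> tuples N ?X" for z
    using that y by (simp add: \<Phi>_def)
  have nrm_\<Phi>: "nrm (multilin_space N ?X Y) \<Phi> = 1"
    unfolding T.nrm_multilin_space
  proof (rule cSup_eq_maximum)
    \<comment> \<open>The off-diagonal pair (0, 1) gives a basis tuple at which the form equals
      1.\<close>
    let ?b = "basis_tuple N (pair_index (0, 1)) :: nat \<Rightarrow> ('k, 'v) point"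
    have "A ?b = 1"
      unfolding A_def off_diagonal_form_basis[OF assms(1)]
      using m by (auto simp: pair_index_def off_diagonal_def)
    moreover have b: "?b \<in> tuples N ?X" by (rule basis_tuple_in)
    ultimately have "nrm Y (\<Phi> ?b) = 1" by (simp only: nrm_\<Phi>_apply norm_one)
    with b show "1 \<in> {nrm Y (\<Phi> x) |x. x \<in> tuples N ?X \<and> (\<forall>j<N. nrm ?E (x j) \<le> 1)}"
      by (intro CollectI exI[of _ ?b]) (simp add: unit_vec(2) del: restrict_PiE_iff)
    fix r assume "r \<in> {nrm Y (\<Phi> x) |x. x \<in> tuples N ?X \<and> (\<forall>j<N. nrm ?E (x j) \<le> 1)}"
    then obtain x where x: "r = nrm Y (\<Phi> x)" "x \<in> tuples N ?X" "\<forall>j<N. nrm ?E (x j) \<le> 1" by blast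
    have "(\<Prod>j<N. nrm ?E (x j)) \<le> 1"
      by (rule prod_le_1) (use x(3) E.nrm_nonneg PiE_mem[OF x(2)] in auto)
    then show "r \<le> 1" using bounded_formD(4)[OF A x(2)] nrm_\<Phi>_apply[OF x(2)] x(1) by simp
  qed
  let ?x = "avg_tuple N m :: nat \<Rightarrow> ('k, 'v) point"
  have xs: "?x \<in> (\<Pi>\<^sub>E j\<in>{..<N}. unit_sphere ?E)"
    using avg[OF m0] unit_vec by (auto simp: avg_tuple_def unit_sphere_def)
  then have x: "?x \<in> tuples N ?X" "\<And>j. j < N \<Longrightarrow> ?x j \<in> carrier ?E"
    by (auto simp: unit_sphere_def PiE_iff)
  have "nrm Y (\<Phi> ?x) = 1 - 1 / real m"
    using m unfolding nrm_\<Phi>_apply[OF x(1)] A_def off_diagonal_form_avg_tuple[OF assms(1) m0] norm_of_real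
    by simp
  then have "nrm Y (\<Phi> ?x) > 1 - \<eta> \<epsilon>" using m(2) by simp
  then obtain \<Psi> \<Psi>'' a where \<Psi>: "\<Psi> \<in> U ?X Y" and a: "a \<in> (\<Pi>\<^sub>E j\<in>{..<N}. unit_sphere (bidual ?E))"
    and nrm_\<Psi>: "nrm (multilin_space N ?X Y) \<Psi> = 1"
    and arens: "arens_extension N ?X Y \<Psi> \<Psi>''" and attain: "nrm (bidual Y) (\<Psi>'' a) = 1"
    and near: "Max ((\<lambda>j. nrm (bidual ?E) (a j \<ominus>\<^bsub>bidual ?E\<^esub> canon ?E (?x j))) ` {..<N}) < \<beta> \<epsilon>"
    and diff: "nrm (ideal_space N U nU ?X Y) (\<Psi> \<ominus>\<^bsub>ideal_space N U nU ?X Y\<^esub> \<Phi>) < \<epsilon>"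
    using LB[rule_format, OF \<epsilon>(2) \<Phi> xs] nrm_\<Phi> by blast
  have aj: "a j \<in> carrier (bidual ?E)" "nrm (bidual ?E) (a j) = 1" if "j < N" for j
    using PiE_mem[OF a, of j] that by (auto simp: unit_sphere_def)
  interpret B: bidual_tuple N ?X a
    by (rule bidual_tuple.intro) (simp_all add: nvs_ell1 aj)
  \<comment> \<open>The distance in the bidual is tested with functionals \<open>coord_sum P\<close>
    of norm at most one.\<close>
  have close: "norm (a k (coord_sum P) - coord_sum P (?x k)) < 1 / 2" if k: "k < N" and P: "finite P" for k P
  proof -
    note c = E.canon_closed[OF x(2)[OF k]]
    have p: "(coord_sum P :: ('k, 'v) point \<Rightarrow> 'k) \<in> carrier (dual ?E)"
      "nrm (dual ?E) (coord_sum P :: ('k, 'v) point \<Rightarrow> 'k) \<le> 1"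
      by (rule coord_sum[OF P])+
    let ?d = "a k \<ominus>\<^bsub>bidual ?E\<^esub> canon ?E (?x k)"
    have d: "?d \<in> carrier (bidual ?E)" using EEE.minus_closed[OF aj(1)[OF k] c] .
    have "nrm (bidual ?E) ?d \<le> Max ((\<lambda>j. nrm (bidual ?E) (a j \<ominus>\<^bsub>bidual ?E\<^esub> canon ?E (?x j))) ` {..<N})"
      by (rule Max_ge[OF finite_imageI[OF finite_lessThan] imageI]) (simp add: k)
    then have "nrm (bidual ?E) ?d < 1 / 2" using near \<epsilon>(1) by linarith
    moreover have "norm (?d (coord_sum P)) \<le> nrm (bidual ?E) ?d * nrm (dual ?E) (coord_sum P)"
      by (rule EE.dualD(4)[OF d p(1)])
    moreover have "nrm (bidual ?E) ?d * nrm (dual ?E) (coord_sum P) \<le> nrm (bidual ?E) ?d * 1"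
      by (rule mult_left_mono[OF p(2) EEE.nrm_nonneg[OF d]])
    moreover have "?d (coord_sum P) = a k (coord_sum P) - coord_sum P (?x k)"
      using EE.dual_minus[OF aj(1)[OF k] c p(1)] p(1) by (simp add: canon_def)
    ultimately show ?thesis by simp
  qed
  obtain i where i: "i < m" and q: "(\<Prod>k<N. a k (coord (pair_index (i, i) k))) \<noteq> 0"
    using common_support[OF B.bidual_tuple_axioms assms(1) m0 close] by blast
  define q where "q = (\<Prod>k<N. a k (coord (pair_index (i, i) k)))"
  obtain F where F: "\<And>j. j < N \<Longrightarrow> bounded_wstar_net ?E (a j) (F j)"
    and lim: "iterated_wlim N ?X Y F \<Psi> 0 (\<lambda>_. undefined) (\<Psi>'' a)"
  proof -
    have "a \<in> tuples N (\<lambda>j. bidual (?X j))"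
      using a by (auto simp: unit_sphere_def PiE_iff)
    then show ?thesis using arens that unfolding arens_extension_def by blast
  qed
  have \<Psi>m: "\<Psi> \<in> carrier (multilin_space N ?X Y)" and \<Phi>m: "\<Phi> \<in> carrier (multilin_space N ?X Y)"
    using ideal_subset_multilin[where X = ?X, OF I banach_space_ell1 Y] \<Psi> \<Phi> by blast+
  let ?D = "\<Psi> \<ominus>\<^bsub>ideal_space N U nU ?X Y\<^esub> \<Phi>"
  have D: "?D \<in> U ?X Y" using I.minus_closed[of \<Psi> \<Phi>] \<Psi> \<Phi> by simp
  have Dm: "?D \<in> carrier (multilin_space N ?X Y)"
    using ideal_subset_multilin[where X = ?X, OF I banach_space_ell1 Y D] .
  have nD: "nU ?X Y ?D < \<epsilon>" using diff by simp
  \<comment> \<open>A bound uniform over the unit ball of \<open>Y'\<close>, obtained by perturbing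
    the scalar form \<open>f (\<Psi> x)\<close> at the diagonal index \<open>i\<close>.\<close>
  have "norm (\<Psi>'' a f) \<le> 1 - (1 - \<epsilon>) * norm q" if f: "f \<in> carrier (dual Y)" "nrm (dual Y) f \<le> 1" for f
  proof -
    have f_le: "norm (f u) \<le> nrm Y u" if "u \<in> carrier Y" for u
      using Y.dualD(4)[OF f(1) that] mult_right_mono[OF f(2) Y.nrm_nonneg[OF that]] by simp
    obtain B where B: "bounded_form N ?X B (\<lambda>x. f (\<Psi> x))"
      using T.bounded_form_comp[OF \<Psi>m f(1) N] .
    have b1: "norm (f (\<Psi> (basis_tuple N \<kappa>))) \<le> 1" for \<kappa>
    proof -
      have "nrm Y (\<Psi> (basis_tuple N \<kappa>)) \<le> 1"
        unfolding nrm_\<Psi>[symmetric]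
        by (rule T.multilin_nrm_ge[OF \<Psi>m N basis_tuple_in]) (simp add: unit_vec(2))
      then show ?thesis
        using f_le[OF multilin_spaceD(2)[OF \<Psi>m basis_tuple_in]] by (rule order_trans[rotated])
    qed
    let ?b = "basis_tuple N (pair_index (i, i)) :: nat \<Rightarrow> ('k, 'v) point"
    have b: "?b \<in> tuples N ?X" by (rule basis_tuple_in)
    have "A ?b = 0"
      unfolding A_def off_diagonal_form_basis[OF assms(1)] by (auto simp: pair_index_def off_diagonal_def)
    then have \<Phi>b: "\<Phi> ?b = \<zero>\<^bsub>Y\<^esub>" unfolding \<Phi>_def using b y by (simp del: restrict_PiE_iff)
    \<comment> \<open>As \<Phi> vanishes at the diagonal tuple, the value of \<Psi> there is that of
      the difference, which the ideal norm controls.\<close>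
    have "?D \<oplus>\<^bsub>ideal_space N U nU ?X Y\<^esub> \<Phi> = \<Psi>"
      by (rule I.minus_add_cancel) (use \<Psi> \<Phi> in simp_all)
    then have "\<Psi> ?b = (?D \<oplus>\<^bsub>ideal_space N U nU ?X Y\<^esub> \<Phi>) ?b" by (simp only:)
    also have "\<dots> = ?D ?b \<oplus>\<^bsub>Y\<^esub> \<Phi> ?b"
      unfolding ideal_space_simps(3) by (rule restrict_apply'[OF b])
    also have "\<dots> = ?D ?b" using multilin_spaceD(2)[OF Dm b] \<Phi>b by simp
    finally have "norm (f (\<Psi> ?b)) \<le> \<epsilon>"
      using ideal_functional_le[OF I banach_space_ell1 Y D f b] nD by (simp add: unit_vec(2) del: restrict_PiE_iff)
    from partial_limit_ell1_bound[OF B.bidual_tuple_axioms B b1 this]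
    have "norm (B.partial_limit (\<lambda>x. f (\<Psi> x)) N (\<lambda>_. undefined)) \<le> 1 - (1 - \<epsilon>) * norm q"
      using \<epsilon> by (simp add: q_def)
    moreover have "\<Psi>'' a f = B.partial_limit (\<lambda>x. f (\<Psi> x)) N (\<lambda>_. undefined)"
      using B.iterated_wlim_eq_partial_limit[OF lim f(1) B F] by simp
    ultimately show ?thesis by simp
  qed
  \<comment> \<open>The bound is independent of \<open>f\<close>, so it passes to the supremum
    defining the norm in \<open>Y''\<close>; as \<open>q\<close> is nonzero, it is strictly below
    1.\<close>
  then have "nrm (bidual Y) (\<Psi>'' a) \<le> 1 - (1 - \<epsilon>) * norm q"
    by (rule YY.dual_nrm_le)
  moreover have "(1 - \<epsilon>) * norm q > 0" using \<epsilon> q by (simp add: q_def)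
  ultimately show False using attain by simp
qed

end
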